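(* Let $n \ge m \ge 1$ and $t \ge 2$ be integers. Let $\Delta_{m,n}$ be the $m\times n$ chessboard complex and $I_{\Delta_{m,n}}$ its Stanley--Reisner ideal. Then the $\mathrm{v}$-number of the $t$-th symbolic power of $I_{\Delta_{m,n}}$ is \[ \mathrm{v}(I_{\Delta_{m,n}}^{(t)})= \begin{cases} 0, & \text{if } m=n=1,\\ t+\left\lceil \frac{t-1}{n-1}\right\rceil, & \text{if } n\ge 2 \text{ and } m=1,\\ t-1+\max\left\{ d_{m,n},\ \left\lceil \frac{t-1+c_{m,n}}{n-1}\right\rceil\right\}, & \text{if } n\ge m\ge 2, \end{cases} \] where $c_{m,n}=m(n-m)+\binom{m}{2}$ and \[ d_{m,n}= \begin{cases} m-1, & \text{if } m=n,\\ m, & \text{if } n>m. \end{cases} \]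
   Context: Let $\mathbb{K}$ be a field and $S=\mathbb{K}[x_{i,j}\mid 1\le i\le m,\ 1\le j\le n]$ the standard graded polynomial ring, $S_d$ its degree $d$ component. The variable $x_{i,j}$ is identified with the square in row $i$ and column $j$ of an $m\times n$ chessboard. Chessboard complex: $\Delta_{m,n}$ is the simplicial complex on the vertex set $V=\{x_{i,j}\mid 1\le i\le m,\ 1\le j\le n\}$ whose faces are the subsets of $V$ with no two squares in the same row or the same column. Stanley--Reisner ideal: for $F\subseteq V$ put $\mathbf{x}_F=\prod_{x\in F}x$. Then $I_{\Delta_{m,n}}=(\mathbf{x}_F\mid F\subseteq V,\ F\notin\Delta_{m,n})\subseteq S$. Symbolic power: for a graded ideal $I\subseteq S$ the $t$-th symbolic power is $I^{(t)}=\left(\bigcap_{\mathfrak{p}\in\operatorname{Min}(I)} I^tS_{\mathfrak{p}}\right)\cap S$, where $\operatorname{Min}(I)$ is the set of minimal primes of $I$ and $S_{\mathfrak{p}}$ is the localization of $S$ at $\mathfrak{p}$. $\mathrm{v}$-number: for a graded ideal $I\subseteq S$, let $\operatorname{Ass}(I)$ be the set of associated primes of $I$ (i.e. of $S/I$). For $\mathfrak{p}\in\operatorname{Ass}(I)$ let $\mathrm{v}_{\mathfrak{p}}(I)=\min\{d\ge 0\mid \text{there exists } f\in S_d \text{ with } (I:f)=\mathfrak{p}\}$, and let $\mathrm{v}(I)=\min\{\mathrm{v}_{\mathfrak{p}}(I)\mid \mathfrak{p}\in\operatorname{Ass}(I)\}$. *)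

theory Defs
  imports
    Complex_Main
    "HOL-Library.Poly_Mapping"
    "HOL-Library.Product_Lexorder"
    "HOL-Library.Extended_Nat"
    "HOL-Computational_Algebra.Fraction_Field"
    "HOL-Algebra.Ideal_Product"
begin

text \<open>
  A square of the board is a pair (row, column), and the same pair indexes the variable
  sitting on it. A polynomial is a finitely supported map from exponent vectors to
  coefficients. The lexicographic order on squares is imported only because the
  \<^class>\<open>idom\<close> instance of \<^type>\<open>poly_mapping\<close> asks for a linear order on the variables.
\<close>

type_synonym square = "nat \<times> nat"
type_synonym 'k square_poly = "(square \<Rightarrow>\<^sub>0 nat) \<Rightarrow>\<^sub>0 'k"


section \<open>The polynomial ring and its grading\<close>

definition polys_in :: "square set \<Rightarrow> 'k::field square_poly set" where
  "polys_in V = {f. \<forall>\<mu> \<in> Poly_Mapping.keys f. Poly_Mapping.keys \<mu> \<subseteq> V}"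

definition poly_ring :: "square set \<Rightarrow> 'k::field square_poly ring" where
  "poly_ring V = \<lparr>carrier = polys_in V, mult = (*), one = 1, zero = 0, add = (+)\<rparr>"

definition poly_var :: "square \<Rightarrow> 'k::field square_poly" where
  "poly_var x = Poly_Mapping.single (Poly_Mapping.single x 1) 1"

definition graded_part :: "square set \<Rightarrow> nat \<Rightarrow> 'k::field square_poly set" where
  "graded_part V d =
     {f \<in> polys_in V. \<forall>\<mu> \<in> Poly_Mapping.keys f.
        (\<Sum>x \<in> Poly_Mapping.keys \<mu>. Poly_Mapping.lookup \<mu> x) = d}"


section \<open>Minimal and associated primes\<close>

definition minimal_primes :: "('a, 'b) ring_scheme \<Rightarrow> 'a set \<Rightarrow> 'a set set" where
  "minimal_primes R I =
     {p. primeideal p R \<and> I \<subseteq> p \<and> (\<forall>q. primeideal q R \<and> I \<subseteq> q \<and> q \<subseteq> p \<longrightarrow> q = p)}"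

definition colon_ideal :: "('a, 'b) ring_scheme \<Rightarrow> 'a set \<Rightarrow> 'a \<Rightarrow> 'a set" where
  "colon_ideal R I f = {g \<in> carrier R. g \<otimes>\<^bsub>R\<^esub> f \<in> I}"

text \<open>
  The annihilator in the quotient by \<open>I\<close> of the class of \<open>f\<close> is the colon ideal of \<open>I\<close> by \<open>f\<close>.
\<close>

definition associated_primes :: "('a, 'b) ring_scheme \<Rightarrow> 'a set \<Rightarrow> 'a set set" where
  "associated_primes R I =
     {p. primeideal p R \<and> (\<exists>f \<in> carrier R. colon_ideal R I f = p)}"


section \<open>Symbolic powers\<close>

text \<open>
  The polynomial ring is a domain, so its localization at a prime \<open>p\<close> is taken inside the field
  of fractions, and the canonical map into it is \<open>f \<mapsto> f / 1\<close>, which is injective.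
\<close>

definition localization_at ::
    "square set \<Rightarrow> 'k::field square_poly set \<Rightarrow> 'k square_poly fract ring" where
  "localization_at V p =
     \<lparr>carrier = {Fraction_Field.Fract a s | a s. a \<in> polys_in V \<and> s \<in> polys_in V - p},
      mult = (*), one = 1, zero = 0, add = (+)\<rparr>"

definition extended_ideal ::
    "square set \<Rightarrow> 'k::field square_poly set \<Rightarrow> 'k square_poly set \<Rightarrow> 'k square_poly fract set" where
  "extended_ideal V p J = Idl\<^bsub>localization_at V p\<^esub> ((\<lambda>g. Fraction_Field.Fract g 1) ` J)"

text \<open>
  The ordinary power of an ideal is its power in the semiring of ideals.
\<close>

definition symbolic_power ::
    "square set \<Rightarrow> 'k::field square_poly set \<Rightarrow> nat \<Rightarrow> 'k square_poly set" where
  "symbolic_power V I t =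
     {f \<in> polys_in V. \<forall>p \<in> minimal_primes (poly_ring V) I.
        Fraction_Field.Fract f 1 \<in> extended_ideal V p (I [^]\<^bsub>ideals_set (poly_ring V)\<^esub> t)}"


section \<open>The v-number\<close>

text \<open>
  The infima are taken in \<^typ>\<open>enat\<close>, where the infimum of the empty set is \<open>\<infinity>\<close> and every
  infimum of a nonempty set is attained: a finite value is therefore a minimum, and asserting
  one includes the existence of a suitable prime and of a homogeneous witness.
\<close>

definition local_v_number ::
    "square set \<Rightarrow> 'k::field square_poly set \<Rightarrow> 'k square_poly set \<Rightarrow> enat" where
  "local_v_number V I p =
     Inf {enat d | d. \<exists>f \<in> graded_part V d. colon_ideal (poly_ring V) I f = p}"

definition v_number :: "square set \<Rightarrow> 'k::field square_poly set \<Rightarrow> enat" where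
  "v_number V I = Inf (local_v_number V I ` associated_primes (poly_ring V) I)"


section \<open>The chessboard complex and its Stanley--Reisner ideal\<close>

definition stanley_reisner_ideal ::
    "square set \<Rightarrow> square set set \<Rightarrow> 'k::field square_poly set" where
  "stanley_reisner_ideal V \<Delta> =
     Idl\<^bsub>poly_ring V\<^esub> {\<Prod>x \<in> F. poly_var x | F. F \<subseteq> V \<and> F \<notin> \<Delta>}"

definition board :: "nat \<Rightarrow> nat \<Rightarrow> square set" where
  "board m n = {1..m} \<times> {1..n}"

definition chessboard_complex :: "nat \<Rightarrow> nat \<Rightarrow> square set set" where
  "chessboard_complex m n =
     {F. F \<subseteq> board m n \<and>
         (\<forall>x \<in> F. \<forall>y \<in> F. x \<noteq> y \<longrightarrow> fst x \<noteq> fst y \<and> snd x \<noteq> snd y)}"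

text \<open>The truncated subtractions below are only used for \<open>1 \<le> m \<le> n\<close>.\<close>

definition c_const :: "nat \<Rightarrow> nat \<Rightarrow> nat" where
  "c_const m n = m * (n - m) + (m choose 2)"

definition d_const :: "nat \<Rightarrow> nat \<Rightarrow> nat" where
  "d_const m n = (if m = n then m - 1 else m)"


section \<open>The rings above are commutative rings\<close>

lemma polys_in_closed:
  "0 \<in> polys_in V" "1 \<in> polys_in V"
  "f \<in> polys_in V \<Longrightarrow> g \<in> polys_in V \<Longrightarrow> f + g \<in> polys_in V"
  "f \<in> polys_in V \<Longrightarrow> g \<in> polys_in V \<Longrightarrow> f * g \<in> polys_in V"
  "f \<in> polys_in V \<Longrightarrow> - f \<in> polys_in V"
proof -
  show "0 \<in> polys_in V" "1 \<in> polys_in V"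
    by (auto simp: polys_in_def)
  show "f + g \<in> polys_in V" if "f \<in> polys_in V" "g \<in> polys_in V"
    using that Poly_Mapping.keys_add[of f g] by (auto simp: polys_in_def)
  show "- f \<in> polys_in V" if "f \<in> polys_in V"
    using that by (auto simp: polys_in_def)
  show "f * g \<in> polys_in V" if fg: "f \<in> polys_in V" "g \<in> polys_in V"
  proof -
    have "Poly_Mapping.keys \<mu> \<subseteq> V" if "\<mu> \<in> Poly_Mapping.keys (f * g)" for \<mu>
    proof -
      from that Poly_Mapping.keys_mult[of f g] obtain a b
        where "\<mu> = a + b" "a \<in> Poly_Mapping.keys f" "b \<in> Poly_Mapping.keys g" by blast
      with fg Poly_Mapping.keys_add[of a b] show ?thesis
        unfolding polys_in_def by blast
    qed
    then show ?thesis by (simp add: polys_in_def)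
  qed
qed

lemma cring_poly_ring: "cring (poly_ring V)"
proof (rule cringI)
  show "abelian_group (poly_ring V)"
  proof (rule abelian_groupI)
    fix x assume "x \<in> carrier (poly_ring V)"
    then show "\<exists>y \<in> carrier (poly_ring V). y \<oplus>\<^bsub>poly_ring V\<^esub> x = \<zero>\<^bsub>poly_ring V\<^esub>"
      by (intro bexI[of _ "- x"]) (auto simp: poly_ring_def polys_in_closed)
  qed (auto simp: poly_ring_def polys_in_closed algebra_simps)
  show "comm_monoid (poly_ring V)"
    by (rule comm_monoidI) (auto simp: poly_ring_def polys_in_closed algebra_simps)
qed (auto simp: poly_ring_def algebra_simps)

lemma cring_localization_at:
  assumes "primeideal p (poly_ring V)"
  shows "cring (localization_at V p)"
proof -
  interpret primeideal p "poly_ring V" by fact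
  let ?L = "localization_at V p"
  have carr: "carrier (poly_ring V) = polys_in V"
    by (simp add: poly_ring_def)
  have z: "0 \<in> p"
    using additive_subgroup.zero_closed[OF is_additive_subgroup] by (simp add: poly_ring_def)
  have one: "1 \<notin> p"
    using one_imp_carrier I_notcarr by (auto simp: poly_ring_def)
  have mul: "s * u \<in> polys_in V - p" if "s \<in> polys_in V - p" "u \<in> polys_in V - p" for s u
    using that I_prime[of s u] by (auto simp: poly_ring_def polys_in_closed)
  have nz: "s \<noteq> 0" if "s \<in> polys_in V - p" for s using that z by auto
  have inL: "Fraction_Field.Fract a s \<in> carrier ?L"
    if "a \<in> polys_in V" "s \<in> polys_in V - p" for a s
    using that by (auto simp: localization_at_def)
  have 0: "0 \<in> carrier ?L" and 1: "1 \<in> carrier ?L"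
    using inL[of 0 1] inL[of 1 1] one
    by (auto simp: polys_in_closed Zero_fract_def One_fract_def)
  have add: "x + y \<in> carrier ?L" and mult: "x * y \<in> carrier ?L"
    if x: "x \<in> carrier ?L" and y: "y \<in> carrier ?L" for x y
  proof -
    from x obtain a s where as: "x = Fraction_Field.Fract a s" "a \<in> polys_in V" "s \<in> polys_in V - p"
      by (auto simp: localization_at_def)
    from y obtain b u where bu: "y = Fraction_Field.Fract b u" "b \<in> polys_in V" "u \<in> polys_in V - p"
      by (auto simp: localization_at_def)
    have "x + y = Fraction_Field.Fract (a * u + b * s) (s * u)"
      using as bu nz by simp
    then show "x + y \<in> carrier ?L"
      using as bu mul by (auto intro!: inL polys_in_closed)
    show "x * y \<in> carrier ?L"
      using as bu mul by (auto intro!: inL polys_in_closed)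
  qed
  have neg: "- x \<in> carrier ?L" if x: "x \<in> carrier ?L" for x
  proof -
    from x obtain a s where "x = Fraction_Field.Fract a s" "a \<in> polys_in V" "s \<in> polys_in V - p"
      by (auto simp: localization_at_def)
    then show ?thesis by (auto intro!: inL polys_in_closed)
  qed
  have ops: "(\<otimes>\<^bsub>?L\<^esub>) = (*)" "(\<oplus>\<^bsub>?L\<^esub>) = (+)" "\<one>\<^bsub>?L\<^esub> = 1" "\<zero>\<^bsub>?L\<^esub> = 0"
    by (simp_all add: localization_at_def)
  show ?thesis
  proof (rule cringI)
    show "abelian_group ?L"
    proof (rule abelian_groupI)
      fix x assume "x \<in> carrier ?L"
      then show "\<exists>y \<in> carrier ?L. y \<oplus>\<^bsub>?L\<^esub> x = \<zero>\<^bsub>?L\<^esub>"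
        by (intro bexI[of _ "- x"]) (auto simp: ops neg)
    qed (auto simp: ops 0 1 add algebra_simps)
    show "comm_monoid ?L"
      by (rule comm_monoidI) (auto simp: ops 1 mult algebra_simps)
  qed (auto simp: ops algebra_simps)
qed

end

theory Submission
  imports Defs
begin

text \<open>
  Two translations turn the statement into an optimization problem on a rectangular array of
  natural numbers.

  The first is algebraic and holds for the Stanley--Reisner ideal of any finite simplicial
  complex. Its minimal primes are generated by the variables off the facets, and the symbolic
  power consists of the polynomials all of whose monomials have degree at least \<open>t\<close> off each
  facet (\<open>symbolic_power_SR\<close>). The key is that the degree off a facet defines a valuation on the
  polynomial ring (\<open>order_ideal_primary\<close>). Since the symbolic power is a monomial ideal whose
  components are primary to the facet primes, a homogeneous polynomial with prime colon ideal
  can be replaced by one of its monomials. The v-number is therefore the least degree of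
  a monomial that has degree \<open>t - 1\<close> off one facet and at least \<open>t\<close> off all others
  (\<open>v_number_symbolic_power_SR\<close>). The board with one square is the exception: its complex is
  a full simplex, the ideal is zero, and the constant polynomial 1 is a witness.

  The second is combinatorial. The facets of the chessboard complex are the injections \<open>\<sigma>\<close> from
  rows to columns, and an exponent vector is an array \<open>a\<close> of weights on the board. The condition
  on the monomial says that \<open>\<sigma>\<close> is the unique assignment of greatest weight \<open>w\<close> and that the total
  weight off \<open>\<sigma>\<close> is \<open>t - 1\<close> (\<open>separates_chessboard_iff\<close>). The degree is \<open>t - 1 + w\<close>, so the task
  is to minimize \<open>w\<close>. Moving one rook to a free column gives \<open>a i j < a i (\<sigma> i)\<close>, and exchanging two
  rooks gives \<open>a i (\<sigma> k) + a k (\<sigma> i) < a i (\<sigma> i) + a k (\<sigma> k)\<close>. Summing these inequalities over all free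
  squares and all pairs of rows yields \<open>t - 1 + c_const m n \<le> (n - 1) * w\<close>
  (\<open>strict_best_off_weight\<close>), and looking at them one at a time yields \<open>d_const m n \<le> w\<close>
  (\<open>strict_best_weight_ge\<close>). Conversely, the array with \<open>a i j = a i i - 1\<close> to the right of the diagonal
  and \<open>a i j = a i i\<close> to its left makes the diagonal the unique best assignment, because every
  other injection moves some row to the right; it gives equality in the first bound, and its
  entries off the diagonal can be lowered to reach any smaller sum
  (\<open>separating_monomial_exists\<close>).
\<close>

(* Exponents and orders are written with the numeral 1; the simplifier must not turn it into
   Suc 0, which would keep facts about order 1 from matching. *)
declare One_nat_def [simp del]

section \<open>Ideals and monomials of the polynomial ring\<close>

lemma poly_ring_simps [simp]:
  "carrier (poly_ring V) = polys_in V"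
  "mult (poly_ring V) = (*)"
  "one (poly_ring V) = 1"
  "zero (poly_ring V) = 0"
  "add (poly_ring V) = (+)"
  by (simp_all add: poly_ring_def)

text \<open>
  In a ring with unit the negative of an element is its multiple by the negative of the unit,
  so an ideal is recognized by sums and multiples alone.
\<close>

lemma (in cring) ideal_criterion:
  assumes "J \<subseteq> carrier R" "\<zero> \<in> J"
    and add: "\<And>a b. a \<in> J \<Longrightarrow> b \<in> J \<Longrightarrow> a \<oplus> b \<in> J"
    and mult: "\<And>a x. a \<in> J \<Longrightarrow> x \<in> carrier R \<Longrightarrow> x \<otimes> a \<in> J"
  shows "ideal J R"
proof (rule idealI)
  show "ring R" by (rule ring_axioms)
  show "subgroup J (add_monoid R)"
  proof (rule group.subgroupI)
    show "group (add_monoid R)" using a_group .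
    show "inv\<^bsub>add_monoid R\<^esub> a \<in> J" if "a \<in> J" for a
    proof -
      have "\<ominus> a = (\<ominus> \<one>) \<otimes> a" using that assms(1) by (simp add: l_minus subset_iff)
      then show ?thesis using mult[OF that, of "\<ominus> \<one>"] by (simp add: a_inv_def)
    qed
  qed (use assms in auto)
  show "x \<otimes> a \<in> J" "a \<otimes> x \<in> J" if "a \<in> J" "x \<in> carrier R" for a x
    using mult[OF that] that assms(1) by (auto simp: m_comm subset_iff)
qed

lemma poly_ideal_closed:
  fixes J :: "'k::field square_poly set"
  assumes "ideal J (poly_ring V)"
  shows "0 \<in> J"
    and "f \<in> J \<Longrightarrow> g \<in> J \<Longrightarrow> f + g \<in> J"
    and "f \<in> J \<Longrightarrow> g \<in> polys_in V \<Longrightarrow> g * f \<in> J"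
    and "f \<in> J \<Longrightarrow> f \<in> polys_in V"
    and "f \<in> J \<Longrightarrow> g \<in> J \<Longrightarrow> f - g \<in> J"
proof -
  interpret ideal J "poly_ring V" by fact
  show "0 \<in> J" using additive_subgroup.zero_closed[OF is_additive_subgroup] by simp
  show add: "f + g \<in> J" if "f \<in> J" "g \<in> J" for f g
    using additive_subgroup.a_closed[OF is_additive_subgroup that] by simp
  show mult: "g * f \<in> J" if "f \<in> J" "g \<in> polys_in V" for f g
    using I_l_closed[OF that(1), of g] that by simp
  show "f \<in> polys_in V" if "f \<in> J" using Icarr[OF that] by simp
  show "f - g \<in> J" if "f \<in> J" "g \<in> J"
    using add[OF that(1) mult[OF that(2), of "-1"]] by (simp add: polys_in_closed)
qed

lemma single_in_polys_in: "Poly_Mapping.keys \<mu> \<subseteq> V \<Longrightarrow> Poly_Mapping.single \<mu> c \<in> polys_in V"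
  by (simp add: polys_in_def)

lemma poly_eq_sum_terms:
  "f = (\<Sum>\<mu>\<in>Poly_Mapping.keys f. Poly_Mapping.single \<mu> (Poly_Mapping.lookup f \<mu>))"
  by (rule poly_mapping_eqI)
    (auto simp: lookup_sum lookup_single when_def in_keys_iff)

lemma ideal_contains_if_terms:
  fixes J :: "'k::field square_poly set"
  assumes J: "ideal J (poly_ring V)"
    and "\<And>\<mu>. \<mu> \<in> Poly_Mapping.keys f \<Longrightarrow> Poly_Mapping.single \<mu> (Poly_Mapping.lookup f \<mu>) \<in> J"
  shows "f \<in> J"
proof -
  have "(\<Sum>\<mu>\<in>K. Poly_Mapping.single \<mu> (Poly_Mapping.lookup f \<mu>)) \<in> J"
    if "finite K" "K \<subseteq> Poly_Mapping.keys f" for K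
    using that by (induction K) (auto simp: poly_ideal_closed[OF J] assms(2))
  then show ?thesis by (subst poly_eq_sum_terms) auto
qed

text \<open>
  Multiplication by a monomial only shifts exponents, hence it merges and cancels nothing.
  This is what allows questions about colon ideals to be decided monomial by monomial.
\<close>

lemma keys_single_mult:
  fixes f :: "'k::field square_poly"
  assumes "c \<noteq> 0"
  shows "Poly_Mapping.keys (Poly_Mapping.single \<mu> c * f) = (+) \<mu> ` Poly_Mapping.keys f"
proof -
  have lookup: "Poly_Mapping.lookup (Poly_Mapping.single \<mu> c * f) (\<mu> + \<nu>)
      = c * Poly_Mapping.lookup f \<nu>" for \<nu>
  proof -
    have "Poly_Mapping.single \<mu> c * f = (\<Sum>\<kappa>\<in>Poly_Mapping.keys f.
        Poly_Mapping.single (\<mu> + \<kappa>) (c * Poly_Mapping.lookup f \<kappa>))"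
      by (subst (1) poly_eq_sum_terms[of f]) (simp add: sum_distrib_left mult_single)
    then show ?thesis
      by (auto simp: lookup_sum lookup_single when_def in_keys_iff)
  qed
  have "Poly_Mapping.keys (Poly_Mapping.single \<mu> c * f) \<subseteq> (+) \<mu> ` Poly_Mapping.keys f"
    using keys_mult[of "Poly_Mapping.single \<mu> c" f] by (auto split: if_splits)
  moreover have "\<mu> + \<nu> \<in> Poly_Mapping.keys (Poly_Mapping.single \<mu> c * f)"
    if "\<nu> \<in> Poly_Mapping.keys f" for \<nu>
    using that assms lookup[of \<nu>] by (simp add: in_keys_iff)
  ultimately show ?thesis by blast
qed

lemma divisible_by_var:
  fixes \<mu> :: "square \<Rightarrow>\<^sub>0 nat"
  assumes "x \<in> Poly_Mapping.keys \<mu>"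
  obtains \<nu> where "\<mu> = Poly_Mapping.single x 1 + \<nu>" "Poly_Mapping.keys \<nu> \<subseteq> Poly_Mapping.keys \<mu>"
proof
  show eq: "\<mu> = Poly_Mapping.single x 1 + (\<mu> - Poly_Mapping.single x 1)"
    using assms
    by (intro poly_mapping_eqI) (auto simp: lookup_add lookup_minus lookup_single when_def in_keys_iff)
  show "Poly_Mapping.keys (\<mu> - Poly_Mapping.single x 1) \<subseteq> Poly_Mapping.keys \<mu>"
    by (auto simp: lookup_minus in_keys_iff)
qed

text \<open>
  The exponent vector of the \<open>k\<close>-th power of the square-free monomial supported on \<open>F\<close>.
\<close>

definition face_exp :: "square set \<Rightarrow> nat \<Rightarrow> square \<Rightarrow>\<^sub>0 nat" where
  "face_exp F k = (\<Sum>x\<in>F. Poly_Mapping.single x k)"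

lemma lookup_face_exp:
  "finite F \<Longrightarrow> Poly_Mapping.lookup (face_exp F k) x = (if x \<in> F then k else 0)"
  by (auto simp: face_exp_def lookup_sum lookup_single when_def)

lemma keys_face_exp: "finite F \<Longrightarrow> Poly_Mapping.keys (face_exp F k) \<subseteq> F"
  by (auto simp: in_keys_iff lookup_face_exp split: if_splits)

lemma face_exp_Suc:
  "face_exp F (Suc k) = face_exp F 1 + face_exp F k"
  by (simp add: face_exp_def single_add[symmetric] sum.distrib[symmetric] One_nat_def)

lemma prod_poly_var:
  "finite F \<Longrightarrow> (\<Prod>x\<in>F. poly_var x :: 'k::field square_poly)
     = Poly_Mapping.single (face_exp F 1) 1"
  by (induction F rule: finite_induct)
    (auto simp: face_exp_def poly_var_def mult_single)


section \<open>The powers of a prime generated by variables\<close>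

definition weight :: "square set \<Rightarrow> (square \<Rightarrow>\<^sub>0 nat) \<Rightarrow> nat" where
  "weight W \<mu> = (\<Sum>x\<in>W. Poly_Mapping.lookup \<mu> x)"

text \<open>
  For \<open>W \<subseteq> V\<close> this is the \<open>t\<close>-th power of the prime ideal generated by the variables of \<open>W\<close>.
  Describing it through the \<open>W\<close>-degree of the monomials makes membership a condition on
  exponent vectors.
\<close>

definition order_ideal :: "square set \<Rightarrow> square set \<Rightarrow> nat \<Rightarrow> 'k::field square_poly set" where
  "order_ideal V W t = {f \<in> polys_in V. \<forall>\<mu>\<in>Poly_Mapping.keys f. t \<le> weight W \<mu>}"

lemma weight_add: "weight W (\<mu> + \<nu>) = weight W \<mu> + weight W \<nu>"
  by (simp add: weight_def lookup_add sum.distrib)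

lemma weight_zero [simp]: "weight W 0 = 0"
  by (simp add: weight_def)

lemma weight_single: "finite W \<Longrightarrow> weight W (Poly_Mapping.single x k) = (if x \<in> W then k else 0)"
  by (simp add: weight_def lookup_single when_def)

lemma weight_Diff: "finite V \<Longrightarrow> F \<subseteq> V \<Longrightarrow> weight (V - F) \<mu> + weight F \<mu> = weight V \<mu>"
  unfolding weight_def by (metis sum.subset_diff)

lemma weight_pos_obtains:
  assumes "0 < weight W \<mu>"
  obtains x where "x \<in> W" "x \<in> Poly_Mapping.keys \<mu>"
  using assms unfolding weight_def in_keys_iff by (metis less_irrefl sum.neutral)

lemma weight_face_exp:
  assumes "finite W" "finite F"
  shows "weight W (face_exp F k) = k * card (W \<inter> F)"
  using assms by (simp add: weight_def lookup_face_exp sum.If_cases)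

lemma order_ideal_in: "f \<in> order_ideal V W t \<Longrightarrow> f \<in> polys_in V"
  by (simp add: order_ideal_def)

lemma order_ideal_add:
  "f \<in> order_ideal V W t \<Longrightarrow> g \<in> order_ideal V W t \<Longrightarrow> f + g \<in> order_ideal V W t"
  using Poly_Mapping.keys_add[of f g] by (auto simp: order_ideal_def polys_in_closed)

lemma order_ideal_mult:
  assumes "f \<in> order_ideal V W a" "g \<in> order_ideal V W b"
  shows "f * g \<in> order_ideal V W (a + b)"
proof -
  have "a + b \<le> weight W \<mu>" if "\<mu> \<in> Poly_Mapping.keys (f * g)" for \<mu>
  proof -
    from that keys_mult[of f g] obtain \<alpha> \<beta>
      where "\<mu> = \<alpha> + \<beta>" "\<alpha> \<in> Poly_Mapping.keys f" "\<beta> \<in> Poly_Mapping.keys g" by blast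
    then show ?thesis using assms by (auto simp: order_ideal_def weight_add add_mono)
  qed
  then show ?thesis using assms by (simp add: order_ideal_def polys_in_closed)
qed

lemma order_ideal_zero [simp]: "order_ideal V W 0 = polys_in V"
  by (simp add: order_ideal_def)

lemma order_ideal_antimono: "s \<le> t \<Longrightarrow> order_ideal V W t \<subseteq> order_ideal V W s"
  by (auto simp: order_ideal_def)

lemma ideal_order_ideal: "ideal (order_ideal V W t) (poly_ring V)"
proof (rule cring.ideal_criterion[OF cring_poly_ring])
  show "x \<otimes>\<^bsub>poly_ring V\<^esub> a \<in> order_ideal V W t"
    if "a \<in> order_ideal V W t" "x \<in> carrier (poly_ring V)" for a x
    using that order_ideal_mult[of x V W 0 a t] by simp
qed (auto simp: order_ideal_add, auto simp: order_ideal_def polys_in_closed)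

lemma single_in_order_ideal:
  "Poly_Mapping.keys \<mu> \<subseteq> V \<Longrightarrow> c \<noteq> 0 \<Longrightarrow>
     Poly_Mapping.single \<mu> c \<in> order_ideal V W t \<longleftrightarrow> t \<le> weight W \<mu>"
  by (simp add: order_ideal_def single_in_polys_in)

lemma initial_part:
  assumes f: "f \<in> order_ideal V W k" "f \<notin> order_ideal V W (Suc k)"
  obtains f0 where "f0 \<in> polys_in V" "f0 \<noteq> 0" "f - f0 \<in> order_ideal V W (Suc k)"
    "\<forall>\<mu>\<in>Poly_Mapping.keys f0. weight W \<mu> = k"
proof -
  define f0 where "f0 = (\<Sum>\<mu>\<in>{\<mu>\<in>Poly_Mapping.keys f. weight W \<mu> = k}.
      Poly_Mapping.single \<mu> (Poly_Mapping.lookup f \<mu>))"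
  have lookup: "Poly_Mapping.lookup f0 \<mu>
      = (if weight W \<mu> = k then Poly_Mapping.lookup f \<mu> else 0)" for \<mu>
    by (auto simp: f0_def lookup_sum lookup_single when_def in_keys_iff)
  have keys: "Poly_Mapping.keys f0 = {\<mu>\<in>Poly_Mapping.keys f. weight W \<mu> = k}"
    by (auto simp: in_keys_iff lookup split: if_splits)
  have keys': "Poly_Mapping.keys (f - f0) = {\<mu>\<in>Poly_Mapping.keys f. weight W \<mu> \<noteq> k}"
    by (auto simp: in_keys_iff lookup_minus lookup split: if_splits)
  show thesis
  proof
    show "f0 \<in> polys_in V" using f(1) by (auto simp: order_ideal_def polys_in_def keys)
    show "f - f0 \<in> order_ideal V W (Suc k)"
      using f(1) by (force simp: order_ideal_def polys_in_def keys' le_less Suc_le_eq)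
    then show "f0 \<noteq> 0" using f(2) by auto
    show "\<forall>\<mu>\<in>Poly_Mapping.keys f0. weight W \<mu> = k" by (simp add: keys)
  qed
qed

lemma order_ideal_exact:
  assumes "f \<in> polys_in V" "f \<notin> order_ideal V W t"
  obtains k where "k < t" "f \<in> order_ideal V W k" "f \<notin> order_ideal V W (Suc k)"
proof -
  define k where "k = (LEAST k. f \<notin> order_ideal V W (Suc k))"
  have "t \<noteq> 0" using assms by (auto intro: ccontr)
  then have ex: "f \<notin> order_ideal V W (Suc (t - 1))" using assms by simp
  have 1: "f \<notin> order_ideal V W (Suc k)" unfolding k_def by (rule LeastI[of _ "t - 1"]) (fact ex)
  have "k \<le> t - 1" unfolding k_def by (rule Least_le) (fact ex)
  moreover have "f \<in> order_ideal V W k"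
  proof (cases k)
    case (Suc j)
    then have "j < (LEAST k. f \<notin> order_ideal V W (Suc k))" by (simp add: k_def)
    from not_less_Least[OF this] show ?thesis using Suc by simp
  qed (use assms in simp)
  ultimately show thesis using that[of k] 1 \<open>t \<noteq> 0\<close> by simp
qed

text \<open>
  The \<open>W\<close>-order is a valuation: the lowest parts of two polynomials have a nonzero product,
  because the polynomial ring is a domain, and this product is the lowest part of the whole
  product. A factor of order zero therefore cannot raise the order.
\<close>

lemma order_ideal_primary:
  assumes f: "f \<in> polys_in V" "f \<notin> order_ideal V W t"
    and g: "g \<in> polys_in V" "g \<notin> order_ideal V W 1"
  shows "f * g \<notin> order_ideal V W t"
proof
  assume fg: "f * g \<in> order_ideal V W t"
  obtain k where k: "k < t" "f \<in> order_ideal V W k" "f \<notin> order_ideal V W (Suc k)"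
    by (rule order_ideal_exact[OF f])
  obtain f0 where f0: "f0 \<in> polys_in V" "f0 \<noteq> 0" "f - f0 \<in> order_ideal V W (Suc k)"
    "\<forall>\<mu>\<in>Poly_Mapping.keys f0. weight W \<mu> = k"
    by (rule initial_part[OF k(2,3)])
  obtain g0 where g0: "g0 \<in> polys_in V" "g0 \<noteq> 0" "g - g0 \<in> order_ideal V W (Suc 0)"
    "\<forall>\<mu>\<in>Poly_Mapping.keys g0. weight W \<mu> = 0"
    by (rule initial_part[of g V W 0]) (use g in \<open>auto simp: One_nat_def\<close>)
  note id = poly_ideal_closed[OF ideal_order_ideal[of V W "Suc k"]]
  have f0k: "f0 \<in> order_ideal V W k" using f0 by (simp add: order_ideal_def)
  have "(f - f0) * g \<in> order_ideal V W (Suc k)"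
    using id(3)[OF f0(3) g(1)] by (simp add: mult.commute)
  moreover have "f0 * (g - g0) \<in> order_ideal V W (Suc k)"
    using order_ideal_mult[OF f0k g0(3)] by simp
  moreover have "f * g \<in> order_ideal V W (Suc k)"
    using fg k(1) order_ideal_antimono[of "Suc k" t V W] by auto
  \<comment> \<open>What remains after removing all contributions of higher order is the product of the
    lowest parts.\<close>
  ultimately have "f * g - ((f - f0) * g + f0 * (g - g0)) \<in> order_ideal V W (Suc k)"
    by (intro id(5) id(2))
  then have "f0 * g0 \<in> order_ideal V W (Suc k)" by (simp add: algebra_simps)
  moreover have "f0 * g0 \<noteq> 0" using f0(2) g0(2) by simp
  then obtain \<mu> where \<mu>: "\<mu> \<in> Poly_Mapping.keys (f0 * g0)" by (metis keys_eq_empty ex_in_conv)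
  moreover from \<mu> have "weight W \<mu> = k"
    using keys_mult[of f0 g0] f0(4) g0(4) by (fastforce simp: weight_add)
  ultimately show False by (auto simp: order_ideal_def)
qed

lemma primeideal_order_ideal:
  "primeideal (order_ideal V W 1 :: 'k::field square_poly set) (poly_ring V)"
proof (rule primeidealI)
  show "cring (poly_ring V)" by (rule cring_poly_ring)
  show "ideal (order_ideal V W 1) (poly_ring V)" by (rule ideal_order_ideal)
  have "(1 :: 'k square_poly) \<notin> order_ideal V W 1" by (simp add: order_ideal_def)
  then show "carrier (poly_ring V) \<noteq> (order_ideal V W 1 :: 'k square_poly set)" by (auto simp: polys_in_closed)
  show "a \<in> order_ideal V W 1 \<or> b \<in> order_ideal V W 1"
    if "a \<in> carrier (poly_ring V)" "b \<in> carrier (poly_ring V)"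
      "a \<otimes>\<^bsub>poly_ring V\<^esub> b \<in> order_ideal V W 1" for a b :: "'k square_poly"
    using that order_ideal_primary[of a V W 1 b] by auto
qed

lemma order_ideal_1_subset:
  fixes J :: "'k::field square_poly set"
  assumes J: "ideal J (poly_ring V)" and W: "\<And>x. x \<in> W \<Longrightarrow> poly_var x \<in> J"
  shows "order_ideal V W 1 \<subseteq> J"
proof
  fix f :: "'k square_poly" assume f: "f \<in> order_ideal V W 1"
  show "f \<in> J"
  proof (rule ideal_contains_if_terms[OF J])
    fix \<mu> assume \<mu>: "\<mu> \<in> Poly_Mapping.keys f"
    then have "0 < weight W \<mu>" and V: "Poly_Mapping.keys \<mu> \<subseteq> V"
      using f by (auto simp: order_ideal_def polys_in_def Suc_le_eq)
    then obtain x where x: "x \<in> W" "x \<in> Poly_Mapping.keys \<mu>" by (blast elim: weight_pos_obtains)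
    obtain \<nu> where \<nu>: "\<mu> = Poly_Mapping.single x 1 + \<nu>" "Poly_Mapping.keys \<nu> \<subseteq> Poly_Mapping.keys \<mu>"
      by (rule divisible_by_var[OF x(2)])
    then have "Poly_Mapping.single \<mu> (Poly_Mapping.lookup f \<mu>)
        = Poly_Mapping.single \<nu> (Poly_Mapping.lookup f \<mu>) * poly_var x"
      by (simp add: poly_var_def mult_single add.commute)
    then show "Poly_Mapping.single \<mu> (Poly_Mapping.lookup f \<mu>) \<in> J"
      using poly_ideal_closed(3)[OF J W[OF x(1)]] V \<nu>(2)
      by (simp add: single_in_polys_in)
  qed
qed


section \<open>Symbolic powers of Stanley--Reisner ideals\<close>

definition facets :: "square set set \<Rightarrow> square set set" where
  "facets \<Delta> = {F \<in> \<Delta>. \<forall>G\<in>\<Delta>. F \<subseteq> G \<longrightarrow> G = F}"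

locale simplicial_complex =
  fixes V :: "square set" and \<Delta> :: "square set set"
  assumes finite_vertices: "finite V"
    and face_subset: "F \<in> \<Delta> \<Longrightarrow> F \<subseteq> V"
    and face_down: "F \<in> \<Delta> \<Longrightarrow> G \<subseteq> F \<Longrightarrow> G \<in> \<Delta>"
begin

abbreviation SR_ideal :: "'k::field square_poly set" where
  "SR_ideal \<equiv> stanley_reisner_ideal V \<Delta>"

lemma finite_faces: "finite \<Delta>"
  using finite_vertices face_subset by (meson Pow_iff finite_Pow_iff finite_subset subsetI)

lemma facet_subset: "F \<in> facets \<Delta> \<Longrightarrow> F \<subseteq> V"
  by (simp add: facets_def face_subset)

lemma finite_facet: "F \<in> facets \<Delta> \<Longrightarrow> finite F"
  using facet_subset finite_vertices finite_subset by blast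

lemma face_in_facet:
  assumes "C \<in> \<Delta>"
  obtains F where "F \<in> facets \<Delta>" "C \<subseteq> F"
  using finite_has_maximal2[OF finite_faces assms] unfolding facets_def by auto

lemma facet_diff_nonempty:
  assumes "F \<in> facets \<Delta>" "G \<in> facets \<Delta>" "G \<noteq> F"
  obtains x where "x \<in> G" "x \<notin> F"
  using assms unfolding facets_def by blast

lemma ideal_SR: "ideal (SR_ideal :: 'k::field square_poly set) (poly_ring V)"
  and SR_generator: "F \<subseteq> V \<Longrightarrow> F \<notin> \<Delta> \<Longrightarrow>
    Poly_Mapping.single (face_exp F 1) (1::'k) \<in> SR_ideal"
  and SR_subset: "ideal J (poly_ring V) \<Longrightarrow>
    (\<And>F. F \<subseteq> V \<Longrightarrow> F \<notin> \<Delta> \<Longrightarrow> Poly_Mapping.single (face_exp F 1) (1::'k) \<in> J) \<Longrightarrow>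
    SR_ideal \<subseteq> J"
proof -
  interpret cring "poly_ring V :: 'k square_poly ring" by (rule cring_poly_ring)
  let ?G = "{\<Prod>x \<in> F. poly_var x :: 'k square_poly | F. F \<subseteq> V \<and> F \<notin> \<Delta>}"
  have prod: "(\<Prod>x\<in>F. poly_var x :: 'k square_poly) = Poly_Mapping.single (face_exp F 1) 1"
    if "F \<subseteq> V" for F
    using that finite_vertices finite_subset by (intro prod_poly_var) blast
  have "?G \<subseteq> carrier (poly_ring V)"
  proof
    fix g assume "g \<in> ?G"
    then obtain F where F: "F \<subseteq> V" "g = (\<Prod>x\<in>F. poly_var x)" by blast
    moreover from F have "Poly_Mapping.keys (face_exp F 1) \<subseteq> V"
      using keys_face_exp[of F 1] finite_vertices finite_subset by blast
    ultimately show "g \<in> carrier (poly_ring V)" by (simp add: prod single_in_polys_in)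
  qed
  then show "ideal SR_ideal (poly_ring V :: 'k square_poly ring)"
    unfolding stanley_reisner_ideal_def by (rule genideal_ideal)
  show "Poly_Mapping.single (face_exp F 1) (1::'k) \<in> SR_ideal" if F: "F \<subseteq> V" "F \<notin> \<Delta>"
  proof -
    have "Poly_Mapping.single (face_exp F 1) (1::'k) \<in> ?G"
      using F by (auto simp: prod[symmetric])
    then show ?thesis unfolding stanley_reisner_ideal_def genideal_def by blast
  qed
  show "SR_ideal \<subseteq> J" if J: "ideal J (poly_ring V)"
    "\<And>F. F \<subseteq> V \<Longrightarrow> F \<notin> \<Delta> \<Longrightarrow> Poly_Mapping.single (face_exp F 1) (1::'k) \<in> J"
  proof -
    have "?G \<subseteq> J"
    proof
      fix g assume "g \<in> ?G"
      then obtain F where F: "F \<subseteq> V" "F \<notin> \<Delta>" "g = (\<Prod>x\<in>F. poly_var x)" by blast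
      show "g \<in> J" using J(2)[OF F(1,2)] unfolding F(3) prod[OF F(1)] .
    qed
    then show ?thesis unfolding stanley_reisner_ideal_def by (rule genideal_minimal[OF J(1)])
  qed
qed

text \<open>
  A nonface has a vertex outside every facet, so its monomial has positive degree off the facet.
\<close>

lemma SR_subset_facet_prime:
  assumes F: "F \<in> facets \<Delta>"
  shows "SR_ideal \<subseteq> order_ideal V (V - F) 1"
proof (rule SR_subset[OF ideal_order_ideal])
  fix N assume N: "N \<subseteq> V" "N \<notin> \<Delta>"
  have "\<not> N \<subseteq> F" using N(2) F face_down unfolding facets_def by blast
  then have "(V - F) \<inter> N \<noteq> {}" using N(1) by blast
  moreover have fin: "finite N" using N(1) finite_vertices finite_subset by blast
  ultimately have "1 \<le> weight (V - F) (face_exp N 1)"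
    using finite_vertices by (simp add: weight_face_exp Suc_le_eq card_gt_0_iff One_nat_def)
  then show "Poly_Mapping.single (face_exp N 1) 1 \<in> order_ideal V (V - F) 1"
    using keys_face_exp[OF fin, of 1] N(1) by (subst single_in_order_ideal) auto
qed

text \<open>
  The vertices whose variables lie outside a prime over the Stanley--Reisner ideal form a face:
  otherwise the product of these variables would be a generator of the ideal although none of
  its factors lies in the prime. Any facet through this face does the job.
\<close>

lemma prime_contains_facet_prime:
  fixes p :: "'k::field square_poly set"
  assumes p: "primeideal p (poly_ring V)" and sub: "SR_ideal \<subseteq> p"
  obtains F where "F \<in> facets \<Delta>" "order_ideal V (V - F) 1 \<subseteq> p"
proof -
  interpret primeideal p "poly_ring V" by fact
  define C where "C = {x \<in> V. (poly_var x :: 'k square_poly) \<notin> p}"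
  have one: "1 \<notin> p" using one_imp_carrier I_notcarr by auto
  have "(\<Prod>x\<in>D. poly_var x :: 'k square_poly) \<in> polys_in V - p" if "finite D" "D \<subseteq> C" for D
    using that
  proof (induction D rule: finite_induct)
    case (insert x D)
    then have "poly_var x \<in> polys_in V - p" unfolding C_def
      by (auto simp: poly_var_def single_in_polys_in)
    with insert I_prime[of "poly_var x" "\<Prod>x\<in>D. poly_var x"] show ?case
      by (auto simp: polys_in_closed)
  qed (simp add: one polys_in_closed)
  moreover have "finite C" "C \<subseteq> V" using finite_vertices by (auto simp: C_def)
  ultimately have "Poly_Mapping.single (face_exp C 1) (1::'k) \<notin> p"
    by (auto simp: prod_poly_var[symmetric])
  then have "C \<in> \<Delta>" using sub SR_generator \<open>C \<subseteq> V\<close> by blast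
  then obtain F where F: "F \<in> facets \<Delta>" "C \<subseteq> F" by (rule face_in_facet)
  have "order_ideal V (V - F) 1 \<subseteq> p"
    by (rule order_ideal_1_subset) (use is_ideal F in \<open>auto simp: C_def\<close>)
  with F(1) show thesis by (rule that)
qed

lemma facet_prime_mono_eq:
  assumes "F \<in> facets \<Delta>" "G \<in> facets \<Delta>"
    and sub: "(order_ideal V (V - G) 1 :: 'k::field square_poly set) \<subseteq> order_ideal V (V - F) 1"
  shows "G = F"
proof (rule ccontr)
  assume "G \<noteq> F"
  then obtain x where x: "x \<in> F" "x \<notin> G"
    using facet_diff_nonempty[OF assms(2,1)] by metis
  have V: "x \<in> V" using facet_subset[OF assms(1)] x by blast
  have "(poly_var x :: 'k square_poly) \<in> order_ideal V W 1 \<longleftrightarrow> x \<in> W" if "W \<subseteq> V" for W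
    unfolding poly_var_def
    by (subst single_in_order_ideal)
      (use V that finite_vertices in \<open>auto simp: weight_single finite_subset\<close>)
  from this[of "V - G"] this[of "V - F"] sub V x show False by blast
qed

lemma minimal_primes_SR:
  "minimal_primes (poly_ring V) (SR_ideal :: 'k::field square_poly set)
     = (\<lambda>F. order_ideal V (V - F) 1) ` facets \<Delta>"
proof (intro subset_antisym subsetI)
  fix p assume p: "p \<in> minimal_primes (poly_ring V) (SR_ideal :: 'k square_poly set)"
  then have "primeideal p (poly_ring V)" "SR_ideal \<subseteq> p"
    and min: "\<And>q. primeideal q (poly_ring V) \<Longrightarrow> SR_ideal \<subseteq> q \<Longrightarrow> q \<subseteq> p \<Longrightarrow> q = p"
    by (auto simp: minimal_primes_def)
  then obtain F where F: "F \<in> facets \<Delta>" "order_ideal V (V - F) 1 \<subseteq> p"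
    by (metis prime_contains_facet_prime)
  have "order_ideal V (V - F) 1 = p"
    by (rule min[OF primeideal_order_ideal SR_subset_facet_prime[OF F(1)] F(2)])
  with F(1) show "p \<in> (\<lambda>F. order_ideal V (V - F) 1) ` facets \<Delta>" by blast
next
  fix p :: "'k square_poly set" assume "p \<in> (\<lambda>F. order_ideal V (V - F) 1) ` facets \<Delta>"
  then obtain F where F: "F \<in> facets \<Delta>" and p: "p = order_ideal V (V - F) 1" by blast
  have "q = p" if q: "primeideal q (poly_ring V)" "SR_ideal \<subseteq> q" "q \<subseteq> p" for q
  proof -
    obtain G where G: "G \<in> facets \<Delta>" "order_ideal V (V - G) 1 \<subseteq> q"
      by (rule prime_contains_facet_prime[OF q(1,2)])
    then have "G = F" using facet_prime_mono_eq[OF F G(1)] q(3) p by blast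
    with G q(3) p show ?thesis by blast
  qed
  then show "p \<in> minimal_primes (poly_ring V) SR_ideal"
    unfolding minimal_primes_def
    using primeideal_order_ideal SR_subset_facet_prime[OF F] p by blast
qed

abbreviation SR_power :: "nat \<Rightarrow> 'k::field square_poly set" where
  "SR_power t \<equiv> SR_ideal [^]\<^bsub>ideals_set (poly_ring V)\<^esub> t"

lemma SR_power_0: "SR_power 0 = polys_in V"
  by (simp add: nat_pow_def ideals_set_def)

lemma SR_power_Suc: "SR_power (Suc t) = ideal_prod (poly_ring V) (SR_power t) SR_ideal"
  by (simp add: nat_pow_def ideals_set_def)

lemma ideal_SR_power: "ideal (SR_power t) (poly_ring V)"
proof (induction t)
  case 0
  show ?case unfolding SR_power_0 using ideal_order_ideal[of V V 0] by simp
next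
  case (Suc t)
  show ?case unfolding SR_power_Suc
    by (rule ring.ideal_prod_is_ideal[OF cring.axioms(1)[OF cring_poly_ring] Suc ideal_SR])
qed

lemma SR_power_subset_order_ideal:
  assumes F: "F \<in> facets \<Delta>"
  shows "(SR_power t :: 'k::field square_poly set) \<subseteq> order_ideal V (V - F) t"
proof (induction t)
  case (Suc t)
  show ?case
  proof
    fix f :: "'k square_poly" assume "f \<in> SR_power (Suc t)"
    then show "f \<in> order_ideal V (V - F) (Suc t)"
      unfolding SR_power_Suc
    proof (induction f rule: ideal_prod.induct)
      case (prod i j)
      then have "i \<in> order_ideal V (V - F) t" "j \<in> order_ideal V (V - F) 1"
        using Suc SR_subset_facet_prime[OF F] by blast+
      from order_ideal_mult[OF this] show ?case by (simp add: Suc_eq_plus1)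
    qed (simp add: order_ideal_add)
  qed
qed (unfold SR_power_0, simp)

text \<open>
  Maximality of \<open>F\<close> makes \<open>insert x F\<close> a nonface for every vertex \<open>x\<close> off \<open>F\<close>, so the product of
  the variable \<open>x\<close> with the monomial of \<open>F\<close> is in the Stanley--Reisner ideal. A monomial that
  contains \<open>t\<close> variables off \<open>F\<close> thus reaches the \<open>t\<close>-th power once it is multiplied by the
  \<open>t\<close>-th power of the monomial of \<open>F\<close>, which is a unit after localizing.
\<close>

lemma single_times_facet_in_SR_power:
  assumes F: "F \<in> facets \<Delta>" and "Poly_Mapping.keys \<mu> \<subseteq> V" "t \<le> weight (V - F) \<mu>"
  shows "Poly_Mapping.single (\<mu> + face_exp F t) c \<in> SR_power t"
  using assms(2,3)
proof (induction t arbitrary: \<mu>)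
  case 0
  then show ?case unfolding SR_power_0 by (simp add: face_exp_def single_in_polys_in)
next
  case (Suc t)
  obtain x where x: "x \<in> V - F" "x \<in> Poly_Mapping.keys \<mu>"
    by (rule weight_pos_obtains[of "V - F" \<mu>]) (use Suc.prems in auto)
  obtain \<nu> where \<nu>: "\<mu> = Poly_Mapping.single x 1 + \<nu>" "Poly_Mapping.keys \<nu> \<subseteq> Poly_Mapping.keys \<mu>"
    by (rule divisible_by_var[OF x(2)])
  have "t \<le> weight (V - F) \<nu>"
    using Suc.prems(2) x(1) finite_vertices by (simp add: \<nu>(1) weight_add weight_single)
  then have "Poly_Mapping.single (\<nu> + face_exp F t) c \<in> SR_power t"
    using Suc.IH \<nu>(2) Suc.prems(1) by blast
  moreover have "insert x F \<notin> \<Delta>" using F x(1) unfolding facets_def by blast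
  then have "Poly_Mapping.single (face_exp (insert x F) 1) 1 \<in> SR_ideal"
    using x(1) facet_subset[OF F] by (intro SR_generator) auto
  ultimately have "Poly_Mapping.single (\<nu> + face_exp F t) c *
      Poly_Mapping.single (face_exp (insert x F) 1) 1 \<in> SR_power (Suc t)"
    unfolding SR_power_Suc using ideal_prod.prod[of _ _ _ _ "poly_ring V"] by simp
  moreover have "face_exp (insert x F) 1 = Poly_Mapping.single x 1 + face_exp F 1"
    using x(1) finite_facet[OF F] by (simp add: face_exp_def)
  ultimately show ?case
    by (simp add: mult_single \<nu>(1) face_exp_Suc algebra_simps)
qed

lemma order_ideal_times_facet_in_SR_power:
  fixes f :: "'k::field square_poly"
  assumes F: "F \<in> facets \<Delta>" and f: "f \<in> order_ideal V (V - F) t"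
  shows "Poly_Mapping.single (face_exp F t) 1 * f \<in> SR_power t"
proof -
  have "Poly_Mapping.single (face_exp F t) 1 *
      (\<Sum>\<mu>\<in>K. Poly_Mapping.single \<mu> (Poly_Mapping.lookup f \<mu>)) \<in> SR_power t"
    if "finite K" "K \<subseteq> Poly_Mapping.keys f" for K
    using that
  proof (induction K)
    case (insert \<mu> K)
    then have "Poly_Mapping.keys \<mu> \<subseteq> V" "t \<le> weight (V - F) \<mu>"
      using f by (auto simp: order_ideal_def polys_in_def)
    from single_times_facet_in_SR_power[OF F this]
    have "Poly_Mapping.single (face_exp F t) 1 *
        Poly_Mapping.single \<mu> (Poly_Mapping.lookup f \<mu>) \<in> SR_power t"
      by (simp add: mult_single add.commute)
    from poly_ideal_closed(2)[OF ideal_SR_power this] insert show ?case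
      by (simp add: distrib_left)
  qed (simp add: poly_ideal_closed(1)[OF ideal_SR_power])
  from this[of "Poly_Mapping.keys f"] show ?thesis by (simp flip: poly_eq_sum_terms)
qed

text \<open>
  From left to right, clearing the denominator \<open>s\<close> of an element of the extended ideal gives
  a product \<open>f * s\<close> of order at least \<open>t\<close>, and \<open>s\<close> has order zero. From right to left, the
  \<open>t\<close>-th power of the monomial of \<open>F\<close> serves as denominator.
\<close>

lemma extended_SR_power_iff:
  fixes f :: "'k::field square_poly"
  assumes F: "F \<in> facets \<Delta>" and f: "f \<in> polys_in V"
  shows "Fraction_Field.Fract f 1 \<in> extended_ideal V (order_ideal V (V - F) 1) (SR_power t)
     \<longleftrightarrow> f \<in> order_ideal V (V - F) t"
proof
  let ?P = "order_ideal V (V - F) 1 :: 'k square_poly set"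
  let ?Q = "order_ideal V (V - F) t :: 'k square_poly set"
  let ?L = "localization_at V ?P"
  let ?gens = "(\<lambda>g. Fraction_Field.Fract g 1) ` (SR_power t :: 'k square_poly set)"
  interpret L: cring ?L by (rule cring_localization_at[OF primeideal_order_ideal])
  have L: "carrier ?L = {Fraction_Field.Fract a s | a s. a \<in> polys_in V \<and> s \<in> polys_in V - ?P}"
    "mult ?L = (*)" "add ?L = (+)" "zero ?L = 0" by (simp_all add: localization_at_def)
  have one: "1 \<in> polys_in V - ?P" by (auto simp: polys_in_closed order_ideal_def)
  have nz: "s \<noteq> 0" if "s \<in> polys_in V - ?P" for s
    using that poly_ideal_closed(1)[OF ideal_order_ideal] by blast
  have mul: "s * u \<in> polys_in V - ?P" if "s \<in> polys_in V - ?P" "u \<in> polys_in V - ?P" for s u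
    using that order_ideal_primary[of s V "V - F" 1 u] by (auto simp: polys_in_closed)
  note Q = poly_ideal_closed[OF ideal_order_ideal[of V "V - F" t, where 'a = 'k]]
  {
    define J where "J = {Fraction_Field.Fract a s | a s. a \<in> ?Q \<and> s \<in> polys_in V - ?P}"
    have J_I: "Fraction_Field.Fract a s \<in> J" if "a \<in> ?Q" "s \<in> polys_in V - ?P" for a s
      using that by (auto simp: J_def)
    have J: "ideal J ?L"
    proof (rule L.ideal_criterion)
      show "J \<subseteq> carrier ?L" using Q(4) by (auto simp: J_def L)
      show "\<zero>\<^bsub>?L\<^esub> \<in> J" using J_I[of 0 1] one Q(1) by (simp add: L Zero_fract_def)
      show "x \<oplus>\<^bsub>?L\<^esub> y \<in> J" if "x \<in> J" "y \<in> J" for x y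
      proof -
        from that(1) obtain a s where
          a: "x = Fraction_Field.Fract a s" "a \<in> ?Q" "s \<in> polys_in V - ?P" unfolding J_def by blast
        from that(2) obtain b u where
          b: "y = Fraction_Field.Fract b u" "b \<in> ?Q" "u \<in> polys_in V - ?P" unfolding J_def by blast
        have "x + y = Fraction_Field.Fract (u * a + s * b) (s * u)"
          using a b nz by (simp add: mult.commute)
        moreover have "u * a + s * b \<in> ?Q" using Q(2,3) a b by blast
        ultimately show ?thesis using J_I mul a(3) b(3) by (simp add: L)
      qed
      show "x \<otimes>\<^bsub>?L\<^esub> y \<in> J" if "y \<in> J" "x \<in> carrier ?L" for x y
      proof -
        from that(1) obtain b u where
          b: "y = Fraction_Field.Fract b u" "b \<in> ?Q" "u \<in> polys_in V - ?P" unfolding J_def by blast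
        from that(2) obtain a s where
          a: "x = Fraction_Field.Fract a s" "a \<in> polys_in V" "s \<in> polys_in V - ?P"
          unfolding L by blast
        have "a * b \<in> ?Q" using Q(3) a b by blast
        then show ?thesis using J_I mul a b by (simp add: L)
      qed
    qed
    have "?gens \<subseteq> J"
      using SR_power_subset_order_ideal[OF F, of t] one by (auto intro!: J_I)
    then have "extended_ideal V ?P (SR_power t) \<subseteq> J"
      unfolding extended_ideal_def by (rule L.genideal_minimal[OF J])
    moreover assume "Fraction_Field.Fract f 1 \<in> extended_ideal V ?P (SR_power t)"
    ultimately obtain a s where
      as: "Fraction_Field.Fract f 1 = Fraction_Field.Fract a s" "a \<in> ?Q" "s \<in> polys_in V - ?P"
      unfolding J_def by blast
    then have "f * s = a" using nz by (simp add: eq_fract)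
    then show "f \<in> ?Q" using order_ideal_primary[OF f, of "V - F" t s] as by auto
  }
  assume fQ: "f \<in> ?Q"
  define s where "s = Poly_Mapping.single (face_exp F t) (1::'k)"
  have keys: "Poly_Mapping.keys (face_exp F t) \<subseteq> V"
    using keys_face_exp[OF finite_facet[OF F]] facet_subset[OF F] by blast
  have "weight (V - F) (face_exp F t) = 0"
    using finite_vertices finite_facet[OF F]
    by (auto simp: weight_face_exp)
  then have "s \<notin> ?P" unfolding s_def by (subst single_in_order_ideal[OF keys]) auto
  then have s: "s \<in> polys_in V - ?P" using keys by (simp add: s_def single_in_polys_in)
  have "?gens \<subseteq> carrier ?L"
    using poly_ideal_closed(4)[OF ideal_SR_power] one by (auto simp: L)
  then have ext: "ideal (extended_ideal V ?P (SR_power t)) ?L"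
    and gens: "?gens \<subseteq> extended_ideal V ?P (SR_power t)"
    unfolding extended_ideal_def using L.genideal_ideal L.genideal_self by auto
  have "Fraction_Field.Fract (s * f) 1 \<in> extended_ideal V ?P (SR_power t)"
    using order_ideal_times_facet_in_SR_power[OF F fQ] gens by (auto simp: s_def)
  moreover have "Fraction_Field.Fract 1 s \<in> carrier ?L"
    using s polys_in_closed(2) by (auto simp: L)
  ultimately have "Fraction_Field.Fract 1 s * Fraction_Field.Fract (s * f) 1
      \<in> extended_ideal V ?P (SR_power t)"
    by (rule ideal.I_l_closed[OF ext, unfolded L(2)])
  moreover have "Fraction_Field.Fract 1 s * Fraction_Field.Fract (s * f) 1 = Fraction_Field.Fract f 1"
    using nz[OF s] by (simp add: eq_fract)
  ultimately show "Fraction_Field.Fract f 1 \<in> extended_ideal V ?P (SR_power t)" by simp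
qed

text \<open>
  Localizing at a minimal prime recovers the power of that prime, so the symbolic power is the
  intersection of the powers of the minimal primes. In particular it is a monomial ideal.
\<close>

theorem symbolic_power_SR:
  "symbolic_power V (SR_ideal :: 'k::field square_poly set) t
     = {f \<in> polys_in V. \<forall>F\<in>facets \<Delta>. f \<in> order_ideal V (V - F) t}"
  unfolding symbolic_power_def minimal_primes_SR using extended_SR_power_iff by auto

end


section \<open>The v-number of a symbolic power\<close>

context simplicial_complex
begin

abbreviation symb :: "nat \<Rightarrow> 'k::field square_poly set" where
  "symb t \<equiv> symbolic_power V SR_ideal t"

text \<open>
  The exponent vectors of the monomials that lie outside the facet component of \<open>F\<close> alone, and
  by a margin of one. These are the monomials whose colon ideal is the minimal prime of \<open>F\<close>.
\<close>

definition separates :: "nat \<Rightarrow> square set \<Rightarrow> (square \<Rightarrow>\<^sub>0 nat) \<Rightarrow> bool" where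
  "separates t F \<mu> \<longleftrightarrow> F \<in> facets \<Delta> \<and> Poly_Mapping.keys \<mu> \<subseteq> V \<and>
     Suc (weight (V - F) \<mu>) = t \<and> (\<forall>G\<in>facets \<Delta> - {F}. t \<le> weight (V - G) \<mu>)"

lemma degree_eq_weight:
  "Poly_Mapping.keys \<mu> \<subseteq> V \<Longrightarrow>
     (\<Sum>x\<in>Poly_Mapping.keys \<mu>. Poly_Mapping.lookup \<mu> x) = weight V \<mu>"
  unfolding weight_def by (rule sum.mono_neutral_left) (auto simp: finite_vertices in_keys_iff)

lemma colon_separating_monomial:
  assumes "separates t F \<mu>"
  shows "colon_ideal (poly_ring V) (symb t) (Poly_Mapping.single \<mu> (1::'k::field))
           = order_ideal V (V - F) 1"
proof (intro subset_antisym subsetI)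
  let ?u = "Poly_Mapping.single \<mu> (1::'k)"
  from assms have F: "F \<in> facets \<Delta>" and V: "Poly_Mapping.keys \<mu> \<subseteq> V"
    and wF: "Suc (weight (V - F) \<mu>) = t"
    and wG: "\<And>G. G \<in> facets \<Delta> \<Longrightarrow> G \<noteq> F \<Longrightarrow> t \<le> weight (V - G) \<mu>"
    unfolding separates_def by auto
  have u: "?u \<in> order_ideal V (V - G) s \<longleftrightarrow> s \<le> weight (V - G) \<mu>" for G s
    by (rule single_in_order_ideal[OF V]) simp
  have uV: "?u \<in> polys_in V" by (rule single_in_polys_in[OF V])
  fix g :: "'k square_poly"
  {
    assume "g \<in> colon_ideal (poly_ring V) (symb t) ?u"
    then have "g \<in> polys_in V" "?u * g \<in> order_ideal V (V - F) t"
      using F by (auto simp: colon_ideal_def symbolic_power_SR mult.commute)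
    then show "g \<in> order_ideal V (V - F) 1"
      using order_ideal_primary[OF uV, of "V - F" t g] u wF by auto
  }
  assume g: "g \<in> order_ideal V (V - F) 1"
  have "g * ?u \<in> order_ideal V (V - G) t" if "G \<in> facets \<Delta>" for G
  proof (cases "G = F")
    case True
    have "?u \<in> order_ideal V (V - F) (weight (V - F) \<mu>)" by (simp add: u)
    from order_ideal_mult[OF g this] show ?thesis
      using wF True by (simp add: Suc_eq_plus1 add.commute)
  next
    case False
    then show ?thesis
      using poly_ideal_closed(3)[OF ideal_order_ideal] u wG[OF that] order_ideal_in[OF g] by blast
  qed
  then show "g \<in> colon_ideal (poly_ring V) (symb t) ?u"
    using order_ideal_in[OF g] uV by (simp add: colon_ideal_def symbolic_power_SR polys_in_closed)
qed

text \<open>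
  If every facet \<open>F\<close> whose component misses \<open>f\<close> had a variable off \<open>F\<close> outside the prime \<open>p\<close>,
  then the product of the \<open>t\<close>-th powers of these variables would multiply \<open>f\<close> into every
  component, hence lie in \<open>p\<close>, against primality.
\<close>

lemma prime_colon_contains_vars:
  fixes p :: "'k::field square_poly set" and f :: "'k square_poly"
  assumes p: "primeideal p (poly_ring V)" and f: "f \<in> polys_in V"
    and colon: "colon_ideal (poly_ring V) (symb t) f = p"
  obtains F where "F \<in> facets \<Delta>" "f \<notin> order_ideal V (V - F) t"
    "\<And>x. x \<in> V - F \<Longrightarrow> poly_var x \<in> p"
proof (rule ccontr)
  assume "\<not> thesis"
  interpret primeideal p "poly_ring V" by fact
  define T where "T = {F \<in> facets \<Delta>. f \<notin> order_ideal V (V - F) t}"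
  have "\<forall>F\<in>T. \<exists>x. x \<in> V - F \<and> (poly_var x :: 'k square_poly) \<notin> p"
    using that \<open>\<not> thesis\<close> unfolding T_def by blast
  then obtain x where x: "\<And>F. F \<in> T \<Longrightarrow> x F \<in> V - F"
    "\<And>F. F \<in> T \<Longrightarrow> (poly_var (x F) :: 'k square_poly) \<notin> p" by metis
  have fin: "finite T" unfolding T_def facets_def using finite_faces by simp
  have one: "1 \<notin> p" using one_imp_carrier I_notcarr by auto
  have pow_notin: "g ^ k \<in> polys_in V - p" if "g \<in> polys_in V - p" for g k
  proof (induction k)
    case (Suc k)
    then show ?case using that I_prime[of g "g ^ k"] by (auto simp: polys_in_closed)
  qed (simp add: one polys_in_closed)
  have var: "poly_var y \<in> polys_in V" if "y \<in> V" for y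
    using that by (simp add: poly_var_def single_in_polys_in)
  have prod_notin: "(\<Prod>F\<in>S. poly_var (x F) ^ t) \<in> polys_in V - p" if "S \<subseteq> T" for S
    using finite_subset[OF that fin] that
  proof (induction S rule: finite_induct)
    case (insert F S)
    then have "poly_var (x F) ^ t \<in> polys_in V - p"
      using x[of F] var[of "x F"] by (intro pow_notin) blast
    with insert I_prime[of "poly_var (x F) ^ t" "\<Prod>F\<in>S. poly_var (x F) ^ t"] show ?case
      by (auto simp: polys_in_closed)
  qed (simp add: one polys_in_closed)
  have pow_in: "(poly_var (x F) ^ k :: 'k square_poly) \<in> order_ideal V (V - F) k"
    if "F \<in> T" for F k
  proof (induction k)
    case (Suc k)
    have "(poly_var (x F) :: 'k square_poly) \<in> order_ideal V (V - F) 1"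
      unfolding poly_var_def
      using x(1)[OF that] finite_vertices by (subst single_in_order_ideal) (auto simp: weight_single)
    from order_ideal_mult[OF this Suc] show ?case by (simp add: One_nat_def)
  qed (simp add: polys_in_closed)
  let ?g = "\<Prod>F\<in>T. (poly_var (x F) ^ t :: 'k square_poly)"
  have g: "?g \<in> polys_in V - p" by (rule prod_notin) simp
  have "?g * f \<in> order_ideal V (V - F) t" if F: "F \<in> facets \<Delta>" for F
  proof (cases "F \<in> T")
    case True
    have "(\<Prod>F\<in>T - {F}. poly_var (x F) ^ t) * f \<in> polys_in V"
      using prod_notin[of "T - {F}"] f by (auto simp: polys_in_closed)
    from order_ideal_mult[OF pow_in[OF True, of t], of _ 0] this
    have "poly_var (x F) ^ t * ((\<Prod>F\<in>T - {F}. poly_var (x F) ^ t) * f) \<in> order_ideal V (V - F) t"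
      by simp
    then show ?thesis by (simp add: prod.remove[OF fin True] mult.assoc)
  next
    case False
    then have "f \<in> order_ideal V (V - F) t" using F by (simp add: T_def)
    then show ?thesis using g poly_ideal_closed(3)[OF ideal_order_ideal] by blast
  qed
  then have "?g \<in> p"
    using g f by (auto simp: colon[symmetric] colon_ideal_def symbolic_power_SR polys_in_closed)
  with g show False by simp
qed

text \<open>
  Witnesses may be taken to be monomials. The variables off a suitable facet \<open>F\<close> annihilate \<open>f\<close>
  modulo the symbolic power, hence, as this is a monomial ideal, each monomial of \<open>f\<close>. At least
  one monomial of \<open>f\<close> has order below \<open>t\<close> at \<open>F\<close>. Multiplying it by a variable off \<open>F\<close> raises
  this order by one, up to \<open>t\<close>, so it was \<open>t - 1\<close>; for another facet \<open>G\<close> a variable in \<open>G\<close> but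
  off \<open>F\<close> leaves the order at \<open>G\<close> unchanged, so it was already at least \<open>t\<close>.
\<close>

lemma prime_colon_obtains_separating:
  fixes p :: "'k::field square_poly set" and f :: "'k square_poly"
  assumes V: "V \<notin> \<Delta>" and p: "primeideal p (poly_ring V)" and f: "f \<in> polys_in V"
    and colon: "colon_ideal (poly_ring V) (symb t) f = p"
  obtains F \<mu> where "separates t F \<mu>" "\<mu> \<in> Poly_Mapping.keys f"
proof -
  interpret primeideal p "poly_ring V" by fact
  obtain F where F: "F \<in> facets \<Delta>" "f \<notin> order_ideal V (V - F) t"
    and var: "\<And>x. x \<in> V - F \<Longrightarrow> poly_var x \<in> p"
    by (rule prime_colon_contains_vars[OF p f colon]) blast
  obtain \<mu> where \<mu>: "\<mu> \<in> Poly_Mapping.keys f" "weight (V - F) \<mu> < t"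
    using F(2) f by (auto simp: order_ideal_def not_le)
  have step: "t \<le> (if x \<in> G then 0 else 1) + weight (V - G) \<mu>"
    if "x \<in> V - F" "G \<in> facets \<Delta>" for x G
  proof -
    have "poly_var x * f \<in> order_ideal V (V - G) t"
      using var[OF that(1)] that(2) by (auto simp: colon[symmetric] colon_ideal_def symbolic_power_SR)
    moreover have "Poly_Mapping.single x 1 + \<mu> \<in> Poly_Mapping.keys (poly_var x * f)"
      using \<mu>(1) by (simp add: poly_var_def keys_single_mult)
    ultimately have "t \<le> weight (V - G) (Poly_Mapping.single x 1 + \<mu>)"
      by (auto simp: order_ideal_def)
    then show ?thesis using that(1) finite_vertices
      by (auto simp: weight_add weight_single split: if_splits)
  qed
  have "F \<noteq> V" using F(1) V by (auto simp: facets_def)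
  then obtain x where x: "x \<in> V - F" using facet_subset[OF F(1)] by blast
  have "Suc (weight (V - F) \<mu>) = t" using step[OF x F(1)] x \<mu>(2) by simp
  moreover have "t \<le> weight (V - G) \<mu>" if "G \<in> facets \<Delta>" "G \<noteq> F" for G
  proof -
    from facet_diff_nonempty[OF F(1) that] obtain y where y: "y \<in> G" "y \<notin> F" .
    then show ?thesis using step[of y G] that facet_subset[OF that(1)] by auto
  qed
  ultimately have "separates t F \<mu>"
    using F(1) \<mu>(1) f by (auto simp: separates_def polys_in_def)
  then show thesis using \<mu>(1) by (rule that)
qed

text \<open>
  The assumption excludes the full simplex, whose only facet prime is zero and contains no
  variable by which a monomial could be moved into the symbolic power.
\<close>

theorem v_number_symbolic_power_SR:
  assumes V: "V \<notin> \<Delta>"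
  shows "v_number V (symb t :: 'k::field square_poly set)
           = Inf {enat (weight V \<mu>) | F \<mu>. separates t F \<mu>}" (is "_ = Inf ?S")
proof (rule antisym)
  show "v_number V (symb t :: 'k square_poly set) \<le> Inf ?S"
  proof (rule Inf_greatest)
    fix d assume "d \<in> ?S"
    then obtain F \<mu> where \<mu>: "separates t F \<mu>" and d: "d = enat (weight V \<mu>)" by blast
    let ?u = "Poly_Mapping.single \<mu> (1::'k)" and ?p = "order_ideal V (V - F) 1 :: 'k square_poly set"
    have keys: "Poly_Mapping.keys \<mu> \<subseteq> V" using \<mu> by (simp add: separates_def)
    have u: "?u \<in> polys_in V" by (rule single_in_polys_in[OF keys])
    note colon = colon_separating_monomial[OF \<mu>, where 'k = 'k]
    have "?p \<in> associated_primes (poly_ring V) (symb t)"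
      unfolding associated_primes_def
      using primeideal_order_ideal u colon by auto
    then have "v_number V (symb t :: 'k square_poly set) \<le> local_v_number V (symb t) ?p"
      unfolding v_number_def by (intro Inf_lower) simp
    also have "?u \<in> graded_part V (weight V \<mu>)"
      using u degree_eq_weight[OF keys] by (simp add: graded_part_def)
    then have "local_v_number V (symb t) ?p \<le> d"
      unfolding local_v_number_def d using colon by (intro Inf_lower) blast
    finally show "v_number V (symb t :: 'k square_poly set) \<le> d" .
  qed
next
  show "Inf ?S \<le> v_number V (symb t :: 'k square_poly set)"
    unfolding v_number_def local_v_number_def
  proof (intro Inf_greatest, clarify, intro Inf_greatest, clarify)
    fix p d and f :: "'k square_poly"
    assume p: "colon_ideal (poly_ring V) (symb t) f \<in> associated_primes (poly_ring V) (symb t)"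
      and f: "f \<in> graded_part V d"
    have fV: "f \<in> polys_in V" using f by (simp add: graded_part_def)
    have "primeideal (colon_ideal (poly_ring V) (symb t) f) (poly_ring V)"
      using p by (simp add: associated_primes_def)
    from prime_colon_obtains_separating[OF V this fV refl]
    obtain F \<mu> where \<mu>: "separates t F \<mu>" "\<mu> \<in> Poly_Mapping.keys f" .
    have "weight V \<mu> = d"
      using f \<mu> degree_eq_weight[of \<mu>] by (auto simp: graded_part_def separates_def)
    then show "Inf ?S \<le> enat d" using \<mu>(1) by (intro Inf_lower) blast
  qed
qed

lemma v_number_symbolic_power_simplex:
  assumes V: "V \<in> \<Delta>" and t: "1 \<le> t"
  shows "v_number V (symb t :: 'k::field square_poly set) = 0"
proof -
  have "facets \<Delta> = {V}" using V face_subset unfolding facets_def by blast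
  moreover have "order_ideal V {} s = ({0} :: 'k square_poly set)" if "1 \<le> s" for s
    using that by (auto simp: order_ideal_def weight_def polys_in_closed)
  ultimately have symb: "symb t = ({0} :: 'k square_poly set)"
    using t by (auto simp: symbolic_power_SR polys_in_closed)
  have colon: "colon_ideal (poly_ring V) {0} 1 = ({0} :: 'k square_poly set)"
    by (auto simp: colon_ideal_def polys_in_closed)
  have "primeideal ({0} :: 'k square_poly set) (poly_ring V)"
    using primeideal_order_ideal[of V "{}", where 'k = 'k] \<open>\<And>s. 1 \<le> s \<Longrightarrow> _\<close>[of 1] by simp
  then have ass: "{0} \<in> associated_primes (poly_ring V) ({0} :: 'k square_poly set)"
    unfolding associated_primes_def using colon by (auto simp: polys_in_closed intro!: bexI[of _ 1])
  have "(1 :: 'k square_poly) \<in> graded_part V 0" by (simp add: graded_part_def polys_in_closed)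
  then have "local_v_number V {0} ({0} :: 'k square_poly set) \<le> enat 0"
    unfolding local_v_number_def using colon by (intro Inf_lower) blast
  moreover have "v_number V ({0} :: 'k square_poly set) \<le> local_v_number V {0} ({0} :: 'k square_poly set)"
    unfolding v_number_def using ass by (intro Inf_lower imageI)
  ultimately show ?thesis by (simp add: symb flip: zero_enat_def)
qed

end


section \<open>Facets of the chessboard complex\<close>

definition placement :: "nat \<Rightarrow> (nat \<Rightarrow> nat) \<Rightarrow> square set" where
  "placement m \<sigma> = (\<lambda>i. (i, \<sigma> i)) ` {1..m}"

lemma finite_board: "finite (board m n)"
  by (simp add: board_def)

lemma simplicial_complex_chessboard: "simplicial_complex (board m n) (chessboard_complex m n)"
proof
  show "G \<in> chessboard_complex m n" if "F \<in> chessboard_complex m n" "G \<subseteq> F" for F G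
    using that unfolding chessboard_complex_def by blast
qed (auto simp: chessboard_complex_def finite_board)

text \<open>
  With at most as many rows as columns, a placement that leaves a row empty also leaves a column
  empty and can be enlarged. The facets are therefore the graphs of the injections from rows to
  columns.
\<close>

lemma facets_chessboard:
  assumes "m \<le> n"
  shows "facets (chessboard_complex m n) =
    {placement m \<sigma> | \<sigma>. inj_on \<sigma> {1..m} \<and> \<sigma> ` {1..m} \<subseteq> {1..n}}"
proof (intro subset_antisym subsetI)
  fix F assume "F \<in> {placement m \<sigma> | \<sigma>. inj_on \<sigma> {1..m} \<and> \<sigma> ` {1..m} \<subseteq> {1..n}}"
  then obtain \<sigma> where \<sigma>: "inj_on \<sigma> {1..m}" "\<sigma> ` {1..m} \<subseteq> {1..n}" and F: "F = placement m \<sigma>" by blast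
  have "F \<in> chessboard_complex m n"
    using \<sigma>(2) by (auto simp: F placement_def chessboard_complex_def board_def
        inj_on_eq_iff[OF \<sigma>(1)])
  moreover have "G = F" if G: "G \<in> chessboard_complex m n" "F \<subseteq> G" for G
  proof -
    have "x \<in> F" if x: "x \<in> G" for x
    proof -
      have in_F: "(fst x, \<sigma> (fst x)) \<in> F"
        using x G(1) by (force simp: F placement_def chessboard_complex_def board_def)
      then have "x = (fst x, \<sigma> (fst x))"
        using G x by (smt (verit, best) chessboard_complex_def fst_conv mem_Collect_eq subsetD)
      then show ?thesis using in_F by simp
    qed
    then show ?thesis using G(2) by blast
  qed
  ultimately show "F \<in> facets (chessboard_complex m n)" by (auto simp: facets_def)
next
  fix F assume "F \<in> facets (chessboard_complex m n)"
  then have F: "F \<in> chessboard_complex m n"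
    and max: "\<And>G. G \<in> chessboard_complex m n \<Longrightarrow> F \<subseteq> G \<Longrightarrow> G = F"
    by (auto simp: facets_def)
  have board: "F \<subseteq> {1..m} \<times> {1..n}" using F by (simp add: chessboard_complex_def board_def)
  then have fin: "finite F" using finite_subset by blast
  have row: "\<exists>j. (i, j) \<in> F" if i: "i \<in> {1..m}" for i
  proof (rule ccontr)
    assume no: "\<nexists>j. (i, j) \<in> F"
    have "inj_on fst F" using F by (auto simp: chessboard_complex_def inj_on_def)
    then have "card F = card (fst ` F)" by (simp add: card_image)
    also have "\<dots> \<le> card ({1..m} - {i})"
      using board no by (intro card_mono) force+
    also have "\<dots> < n" using i assms by auto
    finally have "card (snd ` F) < card {1..n}"
      using card_image_le[OF fin, of snd] by simp
    then obtain j where j: "j \<in> {1..n}" "j \<notin> snd ` F"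
      by (metis card_mono fin finite_imageI not_less subsetI)
    have "insert (i, j) F \<in> chessboard_complex m n"
      using F i j no by (force simp: chessboard_complex_def board_def)
    then show False using max no by blast
  qed
  then obtain \<sigma> where \<sigma>: "\<And>i. i \<in> {1..m} \<Longrightarrow> (i, \<sigma> i) \<in> F" by metis
  have "x \<in> placement m \<sigma>" if x: "x \<in> F" for x
  proof -
    have i: "fst x \<in> {1..m}" using x board by auto
    have "x = (fst x, \<sigma> (fst x))"
      using F x \<sigma>[OF i] by (smt (verit, best) chessboard_complex_def fst_conv mem_Collect_eq)
    then show ?thesis using i unfolding placement_def by (rule image_eqI)
  qed
  then have "F = placement m \<sigma>" using \<sigma> unfolding placement_def by blast
  moreover have "inj_on \<sigma> {1..m}"
  proof (rule inj_onI, rule ccontr)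
    fix i k assume "i \<in> {1..m}" "k \<in> {1..m}" and eq: "\<sigma> i = \<sigma> k" "i \<noteq> k"
    then have "(i, \<sigma> i) \<in> F" "(k, \<sigma> k) \<in> F" using \<sigma> by blast+
    with F eq show False unfolding chessboard_complex_def by force
  qed
  moreover have "\<sigma> ` {1..m} \<subseteq> {1..n}" using \<sigma> board by blast
  ultimately show "F \<in> {placement m \<sigma> | \<sigma>. inj_on \<sigma> {1..m} \<and> \<sigma> ` {1..m} \<subseteq> {1..n}}" by blast
qed

lemma placement_eq_iff: "placement m \<sigma> = placement m \<tau> \<longleftrightarrow> (\<forall>i\<in>{1..m}. \<sigma> i = \<tau> i)"
  by (auto simp: placement_def)

lemma weight_placement:
  "weight (placement m \<sigma>) \<mu> = (\<Sum>i\<in>{1..m}. Poly_Mapping.lookup \<mu> (i, \<sigma> i))"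
  unfolding weight_def placement_def by (subst sum.reindex) (auto simp: inj_on_def)

lemma weight_board:
  "weight (board m n) \<mu> = (\<Sum>i\<in>{1..m}. \<Sum>j\<in>{1..n}. Poly_Mapping.lookup \<mu> (i, j))"
  by (simp add: weight_def board_def sum.cartesian_product)

text \<open>
  The injection \<open>\<sigma>\<close> is the only optimal assignment of columns to rows for the weights \<open>a\<close>.
\<close>

definition strict_best :: "nat \<Rightarrow> nat \<Rightarrow> (nat \<Rightarrow> nat \<Rightarrow> nat) \<Rightarrow> (nat \<Rightarrow> nat) \<Rightarrow> bool" where
  "strict_best m n a \<sigma> \<longleftrightarrow> inj_on \<sigma> {1..m} \<and> \<sigma> ` {1..m} \<subseteq> {1..n} \<and>
     (\<forall>\<tau>. inj_on \<tau> {1..m} \<and> \<tau> ` {1..m} \<subseteq> {1..n} \<and> (\<exists>i\<in>{1..m}. \<tau> i \<noteq> \<sigma> i) \<longrightarrow>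
       (\<Sum>i\<in>{1..m}. a i (\<tau> i)) < (\<Sum>i\<in>{1..m}. a i (\<sigma> i)))"

text \<open>
  The degree off a facet is the total degree minus the weight that the facet collects. Being
  of order \<open>t - 1\<close> at one facet and at least \<open>t\<close> at all others thus says that the first facet
  collects strictly more than any other.
\<close>

lemma separates_chessboard_iff:
  assumes "m \<le> n" and \<sigma>: "inj_on \<sigma> {1..m}" "\<sigma> ` {1..m} \<subseteq> {1..n}"
    and keys: "Poly_Mapping.keys \<mu> \<subseteq> board m n"
  shows "simplicial_complex.separates (board m n) (chessboard_complex m n) t (placement m \<sigma>) \<mu> \<longleftrightarrow>
    strict_best m n (\<lambda>i j. Poly_Mapping.lookup \<mu> (i, j)) \<sigma> \<and>
    weight (board m n) \<mu> + 1 = t + (\<Sum>i\<in>{1..m}. Poly_Mapping.lookup \<mu> (i, \<sigma> i))"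
proof -
  interpret simplicial_complex "board m n" "chessboard_complex m n"
    by (rule simplicial_complex_chessboard)
  note facets = facets_chessboard[OF assms(1)]
  have total: "weight (board m n - placement m \<tau>) \<mu> + (\<Sum>i\<in>{1..m}. Poly_Mapping.lookup \<mu> (i, \<tau> i))
      = weight (board m n) \<mu>" if "\<tau> ` {1..m} \<subseteq> {1..n}" for \<tau>
  proof -
    have "placement m \<tau> \<subseteq> board m n" using that by (auto simp: placement_def board_def)
    from weight_Diff[OF finite_board this, of \<mu>] show ?thesis by (simp add: weight_placement)
  qed
  have mem: "placement m \<sigma> \<in> facets (chessboard_complex m n)" using \<sigma> by (auto simp: facets)
  have ne: "(\<exists>i\<in>{1..m}. \<tau> i \<noteq> \<sigma> i) \<longleftrightarrow> placement m \<tau> \<noteq> placement m \<sigma>" for \<tau>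
    by (simp add: placement_eq_iff)
  have all: "(\<forall>G\<in>facets (chessboard_complex m n) - {placement m \<sigma>}. t \<le> weight (board m n - G) \<mu>)
    \<longleftrightarrow> (\<forall>\<tau>. inj_on \<tau> {1..m} \<and> \<tau> ` {1..m} \<subseteq> {1..n} \<and> (\<exists>i\<in>{1..m}. \<tau> i \<noteq> \<sigma> i) \<longrightarrow>
          t \<le> weight (board m n - placement m \<tau>) \<mu>)"
    unfolding facets ne by blast
  let ?w = "\<lambda>\<tau>. \<Sum>i\<in>{1..m}. Poly_Mapping.lookup \<mu> (i, \<tau> i)"
  have exact: "Suc (weight (board m n - placement m \<sigma>) \<mu>) = t \<longleftrightarrow> weight (board m n) \<mu> + 1 = t + ?w \<sigma>"
    using total[OF \<sigma>(2)] by linarith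
  have "t \<le> weight (board m n - placement m \<tau>) \<mu> \<longleftrightarrow> ?w \<tau> < ?w \<sigma>"
    if "weight (board m n) \<mu> + 1 = t + ?w \<sigma>" "\<tau> ` {1..m} \<subseteq> {1..n}" for \<tau>
    using total[OF that(2)] that(1) by linarith
  then show ?thesis
    unfolding separates_def all strict_best_def exact using mem keys \<sigma> by blast
qed


section \<open>The weight of a strictly best placement\<close>

text \<open>
  Each unordered pair contributes its inequality once, which accounts for the binomial
  coefficient, and every diagonal entry occurs in \<open>card A - 1\<close> pairs.
\<close>

lemma sum_pairs_bound:
  fixes b :: "'a \<Rightarrow> 'a \<Rightarrow> nat"
  assumes "finite A"
    and b: "\<And>i k. i \<in> A \<Longrightarrow> k \<in> A \<Longrightarrow> i \<noteq> k \<Longrightarrow> b i k + b k i < b i i + b k k"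
  shows "(\<Sum>i\<in>A. \<Sum>k\<in>A - {i}. b i k) + (card A choose 2) \<le> (card A - 1) * (\<Sum>i\<in>A. b i i)"
  using assms
proof (induction A rule: finite_induct)
  case (insert x A)
  have "(\<Sum>i\<in>A. \<Sum>k\<in>insert x A - {i}. b i k) = (\<Sum>i\<in>A. b i x + (\<Sum>k\<in>A - {i}. b i k))"
  proof (rule sum.cong[OF refl])
    fix i assume "i \<in> A"
    then have "insert x A - {i} = insert x (A - {i})" using insert.hyps by auto
    then show "(\<Sum>k\<in>insert x A - {i}. b i k) = b i x + (\<Sum>k\<in>A - {i}. b i k)"
      using insert.hyps by simp
  qed
  moreover have "insert x A - {x} = A" using insert.hyps by auto
  ultimately have split: "(\<Sum>i\<in>insert x A. \<Sum>k\<in>insert x A - {i}. b i k)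
      = (\<Sum>i\<in>A. b x i + b i x) + (\<Sum>i\<in>A. \<Sum>k\<in>A - {i}. b i k)"
    using insert.hyps by (simp add: sum.distrib)
  have "(\<Sum>i\<in>A. b x i + b i x + 1) \<le> (\<Sum>i\<in>A. b x x + b i i)"
    using insert.hyps by (intro sum_mono) (use insert.prems in \<open>force simp: Suc_le_eq\<close>)
  then have "(\<Sum>i\<in>A. b x i + b i x) + card A \<le> card A * b x x + (\<Sum>i\<in>A. b i i)"
    by (simp add: sum.distrib)
  moreover have "(\<Sum>i\<in>A. \<Sum>k\<in>A - {i}. b i k) + (card A choose 2) \<le> (card A - 1) * (\<Sum>i\<in>A. b i i)"
    using insert.IH insert.prems by blast
  moreover have "Suc (card A) choose 2 = card A + (card A choose 2)"
    by (simp add: numeral_2_eq_2)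
  moreover have "(card A - 1) * (\<Sum>i\<in>A. b i i) + (\<Sum>i\<in>A. b i i) = card A * (\<Sum>i\<in>A. b i i)"
    using insert.hyps(1) by (cases "card A") (auto simp: algebra_simps)
  ultimately show ?case
    unfolding split using insert.hyps by (simp add: algebra_simps)
qed simp

text \<open>
  Where the competitor agrees with the best assignment both sums have the same terms, so
  the comparison may be restricted to the rows that change.
\<close>

lemma strict_best_less:
  assumes "strict_best m n a \<sigma>" "inj_on \<tau> {1..m}" "\<tau> ` {1..m} \<subseteq> {1..n}"
    and "i \<in> {1..m}" "\<tau> i \<noteq> \<sigma> i"
    and D: "D \<subseteq> {1..m}" "\<And>k. k \<in> {1..m} - D \<Longrightarrow> \<tau> k = \<sigma> k"
  shows "(\<Sum>k\<in>D. a k (\<tau> k)) < (\<Sum>k\<in>D. a k (\<sigma> k))"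
proof -
  have split: "(\<Sum>k\<in>{1..m}. a k (\<rho> k)) = (\<Sum>k\<in>{1..m} - D. a k (\<rho> k)) + (\<Sum>k\<in>D. a k (\<rho> k))" for \<rho>
    using D(1) by (intro sum.subset_diff) auto
  have "(\<Sum>k\<in>{1..m}. a k (\<tau> k)) < (\<Sum>k\<in>{1..m}. a k (\<sigma> k))"
    using assms(1-5) unfolding strict_best_def by blast
  moreover have "(\<Sum>k\<in>{1..m} - D. a k (\<tau> k)) = (\<Sum>k\<in>{1..m} - D. a k (\<sigma> k))"
    using D(2) by (intro sum.cong) auto
  ultimately show ?thesis using split[of \<tau>] split[of \<sigma>] by linarith
qed

context
  fixes m n :: nat and a :: "nat \<Rightarrow> nat \<Rightarrow> nat" and \<sigma> :: "nat \<Rightarrow> nat"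
  assumes best: "strict_best m n a \<sigma>"
begin

private lemma inj: "inj_on \<sigma> {1..m}" and range: "\<sigma> ` {1..m} \<subseteq> {1..n}"
  using best by (auto simp: strict_best_def)

lemma strict_best_free_column:
  assumes i: "i \<in> {1..m}" and j: "j \<in> {1..n} - \<sigma> ` {1..m}"
  shows "a i j < a i (\<sigma> i)"
proof -
  have "inj_on (\<sigma>(i := j)) {1..m}" using inj j by (intro inj_on_fun_updI) auto
  moreover have "(\<sigma>(i := j)) ` {1..m} \<subseteq> {1..n}" using range j by auto
  ultimately have "(\<Sum>k\<in>{i}. a k ((\<sigma>(i := j)) k)) < (\<Sum>k\<in>{i}. a k (\<sigma> k))"
    by (rule strict_best_less[OF best _ _ i]) (use i j in auto)
  then show ?thesis by simp
qed

lemma strict_best_exchange: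
  assumes i: "i \<in> {1..m}" and k: "k \<in> {1..m}" and "i \<noteq> k"
  shows "a i (\<sigma> k) + a k (\<sigma> i) < a i (\<sigma> i) + a k (\<sigma> k)"
proof -
  let ?\<tau> = "\<sigma>(i := \<sigma> k, k := \<sigma> i)"
  have \<tau>_inj: "inj_on ?\<tau> {1..m}"
    by (rule inj_onI) (use i k in \<open>auto simp: inj_on_eq_iff[OF inj] split: if_splits\<close>)
  have "\<sigma> l \<in> {1..n}" if "l \<in> {1..m}" for l using range that by blast
  then have \<tau>_range: "?\<tau> ` {1..m} \<subseteq> {1..n}" using i k by (intro image_subsetI) simp
  have \<tau>_moves: "?\<tau> i \<noteq> \<sigma> i" using i k \<open>i \<noteq> k\<close> by (simp add: inj_on_eq_iff[OF inj])
  have "(\<Sum>l\<in>{i, k}. a l (?\<tau> l)) < (\<Sum>l\<in>{i, k}. a l (\<sigma> l))"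
    by (rule strict_best_less[OF best \<tau>_inj \<tau>_range i \<tau>_moves]) (use i k in auto)
  then show ?thesis using \<open>i \<noteq> k\<close> by simp
qed

text \<open>
  The squares off the placement fall into those in free columns and those in columns used by
  another row. Moving one rook to a free column bounds the former and costs one unit for each of
  the \<open>m * (n - m)\<close> squares; exchanging the columns of two rooks bounds the latter and costs
  one unit for each pair of rows. Together the costs are \<open>c_const m n\<close>.
\<close>

lemma strict_best_off_weight:
  assumes "1 \<le> m" "m \<le> n"
  shows "(\<Sum>i\<in>{1..m}. \<Sum>j\<in>{1..n} - {\<sigma> i}. a i j) + c_const m n \<le> (n - 1) * (\<Sum>i\<in>{1..m}. a i (\<sigma> i))"
proof -
  let ?w = "\<Sum>i\<in>{1..m}. a i (\<sigma> i)" and ?free = "{1..n} - \<sigma> ` {1..m}"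
  have card: "card ?free = n - m" using inj range by (simp add: card_Diff_subset card_image)
  have row: "(\<Sum>j\<in>{1..n} - {\<sigma> i}. a i j) = (\<Sum>j\<in>?free. a i j) + (\<Sum>k\<in>{1..m} - {i}. a i (\<sigma> k))"
    if i: "i \<in> {1..m}" for i
  proof -
    have "{1..n} - {\<sigma> i} = ?free \<union> \<sigma> ` ({1..m} - {i})"
      using range i by (auto simp: inj_on_eq_iff[OF inj])
    then have "(\<Sum>j\<in>{1..n} - {\<sigma> i}. a i j) = (\<Sum>j\<in>?free. a i j) + (\<Sum>j\<in>\<sigma> ` ({1..m} - {i}). a i j)"
      by (simp only:) (rule sum.union_disjoint, auto)
    moreover have "(\<Sum>j\<in>\<sigma> ` ({1..m} - {i}). a i j) = (\<Sum>k\<in>{1..m} - {i}. a i (\<sigma> k))"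
      by (subst sum.reindex) (auto intro: inj_on_subset[OF inj])
    ultimately show ?thesis by simp
  qed
  have "(\<Sum>j\<in>?free. a i j + 1) \<le> (\<Sum>j\<in>?free. a i (\<sigma> i))" if "i \<in> {1..m}" for i
    using strict_best_free_column[OF that] by (intro sum_mono) (simp add: Suc_le_eq flip: Suc_eq_plus1)
  then have "(\<Sum>j\<in>?free. a i j) + (n - m) \<le> (n - m) * a i (\<sigma> i)" if "i \<in> {1..m}" for i
    using that card by (simp add: sum.distrib)
  then have "(\<Sum>i\<in>{1..m}. (\<Sum>j\<in>?free. a i j) + (n - m)) \<le> (\<Sum>i\<in>{1..m}. (n - m) * a i (\<sigma> i))"
    by (rule sum_mono)
  then have free: "(\<Sum>i\<in>{1..m}. \<Sum>j\<in>?free. a i j) + m * (n - m) \<le> (n - m) * ?w"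
    by (simp add: sum.distrib sum_distrib_left)
  have "(\<Sum>i\<in>{1..m}. \<Sum>k\<in>{1..m} - {i}. a i (\<sigma> k)) + (m choose 2) \<le> (m - 1) * ?w"
    using sum_pairs_bound[of "{1..m}" "\<lambda>i k. a i (\<sigma> k)"] strict_best_exchange by simp
  moreover have "(n - m) * ?w + (m - 1) * ?w = (n - 1) * ?w"
    using assms by (simp add: add_mult_distrib[symmetric])
  ultimately show ?thesis
    using free by (simp add: row sum.distrib c_const_def)
qed

text \<open>
  An exchange of two rooks forces a positive weight on one of them, so at most one rook can stand
  on weight zero; when a free column exists, moving a rook there rules out even this one.
\<close>

lemma strict_best_weight_ge:
  assumes "m \<le> n"
  shows "d_const m n \<le> (\<Sum>i\<in>{1..m}. a i (\<sigma> i))"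
proof -
  define Z where "Z = {i \<in> {1..m}. a i (\<sigma> i) = 0}"
  have Z: "Z \<subseteq> {1..m}" "finite Z" unfolding Z_def by auto
  have "card Z \<le> m - d_const m n"
  proof (cases "m = n")
    case True
    have "i = k" if "i \<in> Z" "k \<in> Z" for i k
      using strict_best_exchange[of i k] that unfolding Z_def by force
    then have "card Z \<le> Suc 0" using Z(2) by (meson card_le_Suc0_iff_eq)
    moreover have "m = 0 \<Longrightarrow> Z = {}" using Z(1) by auto
    ultimately show ?thesis using True by (cases "m = 0") (auto simp: d_const_def One_nat_def)
  next
    case False
    have "card (\<sigma> ` {1..m}) < card {1..n}" using inj assms False by (simp add: card_image)
    then obtain j where "j \<in> {1..n} - \<sigma> ` {1..m}"
      by (metis Diff_iff card_mono finite_atLeastAtMost finite_imageI not_less subsetI)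
    then have "Z = {}" using strict_best_free_column unfolding Z_def by force
    then show ?thesis by simp
  qed
  moreover have "card {1..m} = card Z + card ({1..m} - Z)"
    using card_Int_Diff[of "{1..m}" Z] Z(1) by (simp add: Int_absorb1)
  moreover have "d_const m n \<le> m" by (simp add: d_const_def)
  moreover have "card ({1..m} - Z) \<le> (\<Sum>i\<in>{1..m} - Z. a i (\<sigma> i))"
    unfolding card_eq_sum by (rule sum_mono) (auto simp: Z_def One_nat_def)
  moreover have "(\<Sum>i\<in>{1..m} - Z. a i (\<sigma> i)) \<le> (\<Sum>i\<in>{1..m}. a i (\<sigma> i))"
    by (rule sum_mono2) auto
  ultimately show ?thesis by simp
qed

end


section \<open>An exponent vector of least degree\<close>

lemma sum_column_gaps:
  assumes "m \<le> n"
  shows "(\<Sum>i\<in>{1..m}. n - i) = c_const m n"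
  using assms
proof (induction m)
  case (Suc m)
  define k where "k = n - Suc m"
  have n: "n = Suc m + k" using Suc.prems by (simp add: k_def)
  have "(\<Sum>i\<in>{1..Suc m}. n - i) = (\<Sum>i\<in>{1..m}. n - i) + (n - Suc m)"
    by (simp add: One_nat_def)
  also have "(\<Sum>i\<in>{1..m}. n - i) = c_const m n" using Suc by simp
  finally show ?case
    unfolding c_const_def by (simp add: n numeral_2_eq_2 algebra_simps)
qed (simp add: c_const_def)

lemma bounded_function_with_sum:
  fixes f :: "'a \<Rightarrow> nat"
  assumes "finite A" "s \<le> sum f A"
  obtains g where "\<And>x. g x \<le> f x" "sum g A = s"
  using assms
proof (induction A arbitrary: s thesis rule: finite_induct)
  case empty
  then show ?case by (simp add: empty.prems(1)[of f])
next
  case (insert x A)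
  have "s \<le> f x + sum f A" using insert.prems(2) insert.hyps by simp
  then have "s - min s (f x) \<le> sum f A" by linarith
  then obtain g where g: "\<And>y. g y \<le> f y" "sum g A = s - min s (f x)"
    using insert.IH by blast
  have "sum (g(x := min s (f x))) A = sum g A"
    using insert.hyps by (intro sum.cong) auto
  then have "sum (g(x := min s (f x))) (insert x A) = s"
    using insert.hyps g(2) by simp
  then show ?case using g(1) by (intro insert.prems(1)[of "g(x := min s (f x))"]) auto
qed

text \<open>
  An injection with no ascent fixes every point, by induction: a point below \<open>i\<close> is already the
  value of itself and cannot be the value of \<open>i\<close>.
\<close>

lemma injection_not_id_ascends:
  fixes \<tau> :: "nat \<Rightarrow> nat"
  assumes inj: "inj_on \<tau> {1..m}" and range: "\<And>i. i \<in> {1..m} \<Longrightarrow> 1 \<le> \<tau> i"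
    and "k \<in> {1..m}" "\<tau> k \<noteq> k"
  shows "\<exists>i\<in>{1..m}. i < \<tau> i"
proof (rule ccontr)
  assume "\<not> ?thesis"
  then have le: "\<tau> i \<le> i" if "i \<in> {1..m}" for i using that not_less by blast
  have "\<tau> i = i" if "i \<in> {1..m}" for i
    using that
  proof (induction i rule: less_induct)
    case (less i)
    show ?case
    proof (rule ccontr)
      assume "\<tau> i \<noteq> i"
      then have lt: "\<tau> i < i" using le[OF less.prems] by simp
      moreover have mem: "\<tau> i \<in> {1..m}" using range[OF less.prems] lt less.prems by simp
      ultimately have "\<tau> (\<tau> i) = \<tau> i" using less.IH by blast
      then show False using inj_onD[OF inj _ mem less.prems] lt by simp
    qed
  qed
  then show False using assms(3,4) by blast
qed

text \<open>
  The only losses are at ascents, and every competitor of the identity has an ascent.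
\<close>

lemma strict_best_identity:
  assumes "m \<le> n"
    and cap: "\<And>i j. i \<in> {1..m} \<Longrightarrow> j \<in> {1..n} \<Longrightarrow> j \<noteq> i \<Longrightarrow>
      a i j + (if i < j then 1 else 0) \<le> a i i"
  shows "strict_best m n a id"
  unfolding strict_best_def
proof (intro conjI allI impI)
  show "inj_on id {1..m}" by simp
  show "id ` {1..m} \<subseteq> {1..n}" using assms(1) by simp
  fix \<tau> assume "inj_on \<tau> {1..m} \<and> \<tau> ` {1..m} \<subseteq> {1..n} \<and> (\<exists>i\<in>{1..m}. \<tau> i \<noteq> id i)"
  then obtain k where \<tau>: "inj_on \<tau> {1..m}" "\<tau> ` {1..m} \<subseteq> {1..n}" and k: "k \<in> {1..m}" "\<tau> k \<noteq> k"
    by auto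
  have range: "\<tau> i \<in> {1..n}" if "i \<in> {1..m}" for i using \<tau>(2) that by blast
  have "\<exists>l\<in>{1..m}. l < \<tau> l"
    by (rule injection_not_id_ascends[OF \<tau>(1) _ k]) (use range in auto)
  then obtain l where l: "l \<in> {1..m}" "l < \<tau> l" by blast
  have "a i (\<tau> i) \<le> a i i" if "i \<in> {1..m}" for i
    using cap[OF that range[OF that]] by (cases "\<tau> i = i") (auto split: if_splits)
  moreover have "a l (\<tau> l) < a l l" using cap[OF l(1) range[OF l(1)]] l(2) by simp
  ultimately show "(\<Sum>i\<in>{1..m}. a i (\<tau> i)) < (\<Sum>i\<in>{1..m}. a i (id i))"
    using l(1) by (intro sum_strict_mono_ex1) auto
qed

lemma weight_board_split:
  assumes "\<sigma> ` {1..m} \<subseteq> {1..n}"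
  shows "weight (board m n) \<mu> = (\<Sum>i\<in>{1..m}. Poly_Mapping.lookup \<mu> (i, \<sigma> i))
    + (\<Sum>i\<in>{1..m}. \<Sum>j\<in>{1..n} - {\<sigma> i}. Poly_Mapping.lookup \<mu> (i, j))"
proof -
  have "(\<Sum>j\<in>{1..n}. Poly_Mapping.lookup \<mu> (i, j)) = Poly_Mapping.lookup \<mu> (i, \<sigma> i)
      + (\<Sum>j\<in>{1..n} - {\<sigma> i}. Poly_Mapping.lookup \<mu> (i, j))" if "i \<in> {1..m}" for i
    using that assms by (intro sum.remove) blast+
  then show ?thesis by (simp add: weight_board sum.distrib)
qed

text \<open>
  The weights \<open>a i j = a i i - [i < j]\<close> attain equality in the bound on the weight off the
  diagonal and keep the identity strictly best. Lowering entries off the diagonal preserves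
  the latter, so every smaller sum off the diagonal is possible as well.
\<close>

lemma separating_monomial_exists:
  assumes "1 \<le> m" "m \<le> n" "1 \<le> t" and d: "d_const m n \<le> w"
    and c: "t - 1 + c_const m n \<le> (n - 1) * w"
  obtains \<mu> where
    "simplicial_complex.separates (board m n) (chessboard_complex m n) t (placement m id) \<mu>"
    "weight (board m n) \<mu> = t - 1 + w"
proof -
  \<comment> \<open>The last row takes what the others leave, because only there can the diagonal weight be
    zero, namely when no column lies to its right.\<close>
  define \<alpha> where "\<alpha> i = (if i < m then 1 else w - (m - 1))" for i
  have "{1..m} = insert m {1..m - 1}" using assms(1) by auto
  moreover have "(\<Sum>i\<in>{1..m - 1}. \<alpha> i) = (\<Sum>i\<in>{1..m - 1}. 1)"
    unfolding \<alpha>_def using assms(1) by (intro sum.cong) auto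
  moreover have "m - 1 \<le> w" using d by (auto simp: d_const_def split: if_splits)
  ultimately have sum_\<alpha>: "(\<Sum>i\<in>{1..m}. \<alpha> i) = w" using assms(1) by (simp add: \<alpha>_def)
  define f where "f = (\<lambda>(i, j). \<alpha> i - (if i < j then 1 else 0 :: nat))"
  have pos: "1 \<le> \<alpha> i" if "i \<in> {1..m}" "i < j" "j \<in> {1..n}" for i j
  proof (cases "i < m")
    case False
    then have "m \<noteq> n" using that by auto
    then show ?thesis using d False assms(1) by (simp add: \<alpha>_def d_const_def)
  qed (simp add: \<alpha>_def)
  have f: "f (i, j) + (if i < j then 1 else 0) = \<alpha> i" if "i \<in> {1..m}" "j \<in> {1..n}" for i j
    using pos[OF that(1) _ that(2)] by (auto simp: f_def)
  define off_diag where "off_diag = (SIGMA i:{1..m}. {1..n} - {i})"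
  have off_diag: "finite off_diag" by (simp add: off_diag_def)
  have sum_off_diag: "sum F off_diag = (\<Sum>i\<in>{1..m}. \<Sum>j\<in>{1..n} - {i}. F (i, j))" for F :: "square \<Rightarrow> nat"
    by (simp add: off_diag_def sum.Sigma)
  have gaps: "(\<Sum>j\<in>{1..n} - {i}. if i < j then 1 else 0 :: nat) = n - i" if "i \<in> {1..m}" for i
  proof -
    have "({1..n} - {i}) \<inter> {j. i < j} = {i<..n}" using that by auto
    then show ?thesis by (simp add: sum.If_cases)
  qed
  have "(\<Sum>x\<in>off_diag. f x) + (\<Sum>i\<in>{1..m}. n - i)
      = (\<Sum>i\<in>{1..m}. \<Sum>j\<in>{1..n} - {i}. f (i, j) + (if i < j then 1 else 0))"
    by (simp add: sum_off_diag sum.distrib gaps)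
  also have "\<dots> = (\<Sum>i\<in>{1..m}. \<Sum>j\<in>{1..n} - {i}. \<alpha> i)"
    using f by (intro sum.cong refl) auto
  also have "\<dots> = (n - 1) * w"
    using assms(2) by (simp flip: sum_\<alpha> add: sum_distrib_left)
  finally have "t - 1 \<le> (\<Sum>x\<in>off_diag. f x)" using c by (simp add: sum_column_gaps[OF assms(2)])
  then obtain g where g: "\<And>x. g x \<le> f x" "sum g off_diag = t - 1"
    using bounded_function_with_sum[OF off_diag] by blast
  define h where "h x = (if x \<in> off_diag then g x else \<alpha> (fst x))" for x
  define \<mu> where "\<mu> = (\<Sum>x\<in>board m n. Poly_Mapping.single x (h x))"
  have lookup: "Poly_Mapping.lookup \<mu> x = (if x \<in> board m n then h x else 0)" for x
    by (simp add: \<mu>_def lookup_sum lookup_single when_def finite_board)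
  have diag: "Poly_Mapping.lookup \<mu> (i, i) = \<alpha> i" if "i \<in> {1..m}" for i
    using that assms(2) by (simp add: lookup h_def off_diag_def board_def)
  have off: "Poly_Mapping.lookup \<mu> (i, j) = g (i, j)" if "i \<in> {1..m}" "j \<in> {1..n} - {i}" for i j
    using that by (simp add: lookup h_def off_diag_def board_def)
  have best: "strict_best m n (\<lambda>i j. Poly_Mapping.lookup \<mu> (i, j)) id"
  proof (rule strict_best_identity[OF assms(2)])
    fix i j assume ij: "i \<in> {1..m}" "j \<in> {1..n}" "j \<noteq> i"
    then show "Poly_Mapping.lookup \<mu> (i, j) + (if i < j then 1 else 0) \<le> Poly_Mapping.lookup \<mu> (i, i)"
      using f[OF ij(1,2)] g(1)[of "(i, j)"] off[of i j] diag[OF ij(1)] by auto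
  qed
  have diag_sum: "(\<Sum>i\<in>{1..m}. Poly_Mapping.lookup \<mu> (i, id i)) = w"
    using diag sum_\<alpha> by simp
  have "(\<Sum>i\<in>{1..m}. \<Sum>j\<in>{1..n} - {id i}. Poly_Mapping.lookup \<mu> (i, j)) = sum g off_diag"
    unfolding sum_off_diag using off by simp
  then have total: "weight (board m n) \<mu> = t - 1 + w"
    using weight_board_split[of id m n \<mu>] diag_sum g(2) assms(2) by simp
  have "Poly_Mapping.keys \<mu> \<subseteq> board m n" by (auto simp: in_keys_iff lookup split: if_splits)
  then have "simplicial_complex.separates (board m n) (chessboard_complex m n) t (placement m id) \<mu>"
    using separates_chessboard_iff[OF assms(2), of id \<mu> t] best total diag_sum assms(2,3) by simp
  then show thesis using total by (rule that)
qed

text \<open>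
  The witness \<open>w\<close> is the weight that the facet collects from the monomial.
\<close>

lemma separating_monomial_degree:
  assumes "1 \<le> m" "m \<le> n" "1 \<le> t"
    and sep: "simplicial_complex.separates (board m n) (chessboard_complex m n) t F \<mu>"
  obtains w where "d_const m n \<le> w" "t - 1 + c_const m n \<le> (n - 1) * w"
    "weight (board m n) \<mu> = t - 1 + w"
proof -
  interpret simplicial_complex "board m n" "chessboard_complex m n"
    by (rule simplicial_complex_chessboard)
  obtain \<sigma> where \<sigma>: "inj_on \<sigma> {1..m}" "\<sigma> ` {1..m} \<subseteq> {1..n}" and F: "F = placement m \<sigma>"
    using sep unfolding separates_def facets_chessboard[OF assms(2)] by blast
  have "Poly_Mapping.keys \<mu> \<subseteq> board m n" using sep by (simp add: separates_def)
  then have best: "strict_best m n (\<lambda>i j. Poly_Mapping.lookup \<mu> (i, j)) \<sigma>"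
    and total: "weight (board m n) \<mu> + 1 = t + (\<Sum>i\<in>{1..m}. Poly_Mapping.lookup \<mu> (i, \<sigma> i))"
    using separates_chessboard_iff[OF assms(2) \<sigma>] sep F by auto
  show thesis
  proof
    show "d_const m n \<le> (\<Sum>i\<in>{1..m}. Poly_Mapping.lookup \<mu> (i, \<sigma> i))"
      by (rule strict_best_weight_ge[OF best assms(2)])
    show "weight (board m n) \<mu> = t - 1 + (\<Sum>i\<in>{1..m}. Poly_Mapping.lookup \<mu> (i, \<sigma> i))"
      using total assms(3) by simp
    then show "t - 1 + c_const m n \<le> (n - 1) * (\<Sum>i\<in>{1..m}. Poly_Mapping.lookup \<mu> (i, \<sigma> i))"
      using strict_best_off_weight[OF best assms(1,2)] weight_board_split[OF \<sigma>(2), of \<mu>] by simp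
  qed
qed


section \<open>The v-number of the chessboard complex\<close>

lemma nat_ceiling_ratio_le_iff:
  assumes "2 \<le> n" "1 \<le> t"
  shows "nat \<lceil>(real t - 1 + real c) / (real n - 1)\<rceil> \<le> w \<longleftrightarrow> t - 1 + c \<le> (n - 1) * w"
proof -
  have "nat \<lceil>(real t - 1 + real c) / (real n - 1)\<rceil> \<le> w
      \<longleftrightarrow> real t - 1 + real c \<le> (real n - 1) * real w"
    using assms by (simp add: nat_ceiling_le_eq pos_divide_le_eq mult.commute)
  also have "\<dots> \<longleftrightarrow> real (t - 1 + c) \<le> real ((n - 1) * w)"
    using assms by (simp add: of_nat_diff algebra_simps)
  finally show ?thesis by (simp only: of_nat_le_iff)
qed

lemma v_number_chessboard:
  assumes "1 \<le> m" "m \<le> n" "2 \<le> n" "1 \<le> t"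
  shows "v_number (board m n) (symbolic_power (board m n)
      (stanley_reisner_ideal (board m n) (chessboard_complex m n) :: 'k::field square_poly set) t)
    = enat (t - 1 + max (d_const m n)
        (nat \<lceil>(real t - 1 + real (c_const m n)) / (real n - 1)\<rceil>))"
proof -
  interpret simplicial_complex "board m n" "chessboard_complex m n"
    by (rule simplicial_complex_chessboard)
  let ?w = "max (d_const m n) (nat \<lceil>(real t - 1 + real (c_const m n)) / (real n - 1)\<rceil>)"
  have w: "?w \<le> w \<longleftrightarrow> d_const m n \<le> w \<and> t - 1 + c_const m n \<le> (n - 1) * w" for w
    using nat_ceiling_ratio_le_iff[OF assms(3,4)] by simp
  have "(1, 1) \<in> board m n" "(1, 2) \<in> board m n" using assms by (auto simp: board_def)
  then have "board m n \<notin> chessboard_complex m n" by (force simp: chessboard_complex_def)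
  note v = v_number_symbolic_power_SR[OF this, of t, where 'k = 'k]
  show ?thesis unfolding v
  proof (rule antisym)
    obtain \<mu> where "separates t (placement m id) \<mu>" "weight (board m n) \<mu> = t - 1 + ?w"
      using separating_monomial_exists[OF assms(1,2,4)] w[of ?w] by (metis order_refl)
    then show "Inf {enat (weight (board m n) \<mu>) | F \<mu>. separates t F \<mu>} \<le> enat (t - 1 + ?w)"
      by (intro Inf_lower) force
    show "enat (t - 1 + ?w) \<le> Inf {enat (weight (board m n) \<mu>) | F \<mu>. separates t F \<mu>}"
    proof (rule Inf_greatest, clarify)
      fix F \<mu> assume "separates t F \<mu>"
      then obtain w where "d_const m n \<le> w" "t - 1 + c_const m n \<le> (n - 1) * w"
        "weight (board m n) \<mu> = t - 1 + w"
        by (rule separating_monomial_degree[OF assms(1,2,4)])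
      then show "enat (t - 1 + ?w) \<le> enat (weight (board m n) \<mu>)" using w[of w] by simp
    qed
  qed
qed

text \<open>
  With a single row the constant \<open>c_const 1 n\<close> is \<open>n - 1\<close> and raises the ceiling by exactly one,
  so the second term dominates \<open>d_const 1 n = 1\<close>.
\<close>

lemma max_one_row:
  assumes "2 \<le> n" "1 \<le> t"
  shows "t - 1 + max (d_const 1 n) (nat \<lceil>(real t - 1 + real (c_const 1 n)) / (real n - 1)\<rceil>)
    = t + nat \<lceil>(real t - 1) / (real n - 1)\<rceil>"
proof -
  have "(real t - 1 + real (c_const 1 n)) / (real n - 1) = (real t - 1) / (real n - 1) + 1"
    using assms by (simp add: c_const_def of_nat_diff add_divide_distrib numeral_2_eq_2 One_nat_def
        field_simps)
  then have "\<lceil>(real t - 1 + real (c_const 1 n)) / (real n - 1)\<rceil> = \<lceil>(real t - 1) / (real n - 1)\<rceil> + 1"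
    by simp
  moreover have "0 \<le> \<lceil>(real t - 1) / (real n - 1)\<rceil>"
    using assms by (simp add: divide_nonneg_nonneg order_less_le_trans[of _ 0])
  ultimately have "nat \<lceil>(real t - 1 + real (c_const 1 n)) / (real n - 1)\<rceil>
      = nat \<lceil>(real t - 1) / (real n - 1)\<rceil> + 1"
    by (simp add: nat_add_distrib)
  then show ?thesis using assms by (simp add: d_const_def)
qed

theorem theorem1p3:
  fixes m n t :: nat
    and I :: "'k::field square_poly set"
  assumes "1 \<le> m" and "m \<le> n" and "2 \<le> t"
    and "I = stanley_reisner_ideal (board m n) (chessboard_complex m n)"
  shows "v_number (board m n) (symbolic_power (board m n) I t) = enat
    (if m = 1 \<and> n = 1 then 0
     else if m = 1 then t + nat \<lceil>(real t - 1) / (real n - 1)\<rceil>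
     else t - 1 + max (d_const m n)
                      (nat \<lceil>(real t - 1 + real (c_const m n)) / (real n - 1)\<rceil>))"
proof (cases "n = 1")
  case True
  then have m: "m = 1" using assms(1,2) by simp
  interpret simplicial_complex "board m n" "chessboard_complex m n"
    by (rule simplicial_complex_chessboard)
  have "board m n \<in> chessboard_complex m n"
    by (auto simp: m True board_def chessboard_complex_def)
  then show ?thesis
    using v_number_symbolic_power_simplex[of t, where 'k = 'k] assms(3)
    by (simp add: assms(4) m True zero_enat_def)
next
  case False
  then have n: "2 \<le> n" and t: "1 \<le> t" using assms(1,2,3) by auto
  have "v_number (board m n) (symbolic_power (board m n) I t) = enat (t - 1 + max (d_const m n)
        (nat \<lceil>(real t - 1 + real (c_const m n)) / (real n - 1)\<rceil>))"
    unfolding assms(4) by (rule v_number_chessboard[OF assms(1,2) n t])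
  also have "\<dots> = enat
    (if m = 1 \<and> n = 1 then 0
     else if m = 1 then t + nat \<lceil>(real t - 1) / (real n - 1)\<rceil>
     else t - 1 + max (d_const m n)
                      (nat \<lceil>(real t - 1 + real (c_const m n)) / (real n - 1)\<rceil>))"
    using max_one_row[OF n t] False by simp
  finally show ?thesis .
qed

end
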